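(* A bounded linear operator $\widetilde S$ on $\mathcal{F}(\mathbb{C}^n)$ commutes with $\rho(ib)$ for all $b\in\mathbb{R}^n$ if and only if there exists $m\in L^\infty(\mathbb{R}^n)$ such that for all $F\in\mathcal{F}(\mathbb{C}^n)$ and $z\in\mathbb{C}^n$ $$\widetilde SF(z)=e^{-\frac14 z^2}\int_{\mathbb{R}^n}m(\xi)\,B^*F(\xi)\,e^{-\frac12|\xi|^2}\,e^{z\cdot\xi}\,d\xi.$$
   Context: For $z,w\in\mathbb{C}^n$ write $z\cdot w=\sum_j z_jw_j$ and $z^2=z\cdot z$. Let $d\nu(z)=c_ne^{-\frac12|z|^2}dz$ on $\mathbb{C}^n$ with $c_n=(2\pi)^{-n}$; the Fock space $\mathcal{F}(\mathbb{C}^n)$ is the Hilbert space of entire functions on $\mathbb{C}^n$ square integrable with respect to $\nu$. For $b\in\mathbb{R}^n$, $\rho(ib)$ is the unitary operator on $\mathcal{F}(\mathbb{C}^n)$ given by $\rho(ib)F(z)=F(z+ib)\,e^{\frac12 ib\cdot z}\,e^{-\frac14|b|^2}$. The Bargmann transform $B:L^2(\mathbb{R}^n)\to\mathcal{F}(\mathbb{C}^n)$ is, up to a positive normalizing constant which makes it unitary, $Bf(z)=e^{-\frac14z^2}\int_{\mathbb{R}^n}f(u)e^{-\frac12|u|^2}e^{u\cdot z}du$, and $B^*$ is its adjoint (inverse). *)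

theory Defs
  imports "HOL-Analysis.Analysis"
begin

text \<open>The bilinear product on complex vectors, without conjugation; the class operation
  \<open>inner\<close> on \<open>complex ^ 'n\<close> is the real inner product instead.\<close>

definition cdot :: "complex ^ 'n \<Rightarrow> complex ^ 'n \<Rightarrow> complex"
  where "cdot z w = (\<Sum>j\<in>UNIV. z $ j * w $ j)"

definition of_real_vec :: "real ^ 'n \<Rightarrow> complex ^ 'n"
  where "of_real_vec x = (\<chi> j. complex_of_real (x $ j))"

text \<open>Elements of \<open>L\<^sup>2\<close> and \<open>L\<^sup>\<infinity>\<close> are represented by measurable functions rather than by
  classes modulo almost everywhere equality; every class of Lebesgue measurable functions has
  a Borel representative, so \<open>lborel\<close> gives the usual spaces over Euclidean space.\<close>

definition L2 :: "'a measure \<Rightarrow> ('a \<Rightarrow> complex) set"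
  where "L2 M = {f \<in> borel_measurable M. integrable M (\<lambda>x. (norm (f x))\<^sup>2)}"

definition L2_inner :: "'a measure \<Rightarrow> ('a \<Rightarrow> complex) \<Rightarrow> ('a \<Rightarrow> complex) \<Rightarrow> complex"
  where "L2_inner M f g = (LINT x|M. f x * cnj (g x))"

definition L2_norm :: "'a measure \<Rightarrow> ('a \<Rightarrow> complex) \<Rightarrow> real"
  where "L2_norm M f = sqrt (LINT x|M. (norm (f x))\<^sup>2)"

definition Linfty :: "'a measure \<Rightarrow> ('a \<Rightarrow> complex) set"
  where "Linfty M = {f \<in> borel_measurable M. \<exists>K::real. AE x in M. norm (f x) \<le> K}"

definition fock_measure :: "(complex ^ 'n) measure"
  where "fock_measure =
    density lborel (\<lambda>z. ennreal (1 / (2 * pi) ^ CARD('n) * exp (- (norm z)\<^sup>2 / 2)))"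

text \<open>A function is entire if its (real) Frechet derivative exists and is complex linear at
  every point.\<close>

definition entire :: "(complex ^ 'n \<Rightarrow> complex) \<Rightarrow> bool"
  where "entire F \<longleftrightarrow>
    (\<forall>z. \<exists>D. (F has_derivative D) (at z) \<and> (\<forall>c v. D (c *s v) = c * D v))"

definition fock :: "(complex ^ 'n \<Rightarrow> complex) set"
  where "fock = {F \<in> L2 fock_measure. entire F}"

text \<open>An operator is a map on all functions of which only the restriction to the Fock space
  matters.\<close>

definition fock_bounded_linear ::
    "((complex ^ 'n \<Rightarrow> complex) \<Rightarrow> (complex ^ 'n \<Rightarrow> complex)) \<Rightarrow> bool"
  where "fock_bounded_linear S \<longleftrightarrow>
    (\<forall>F\<in>fock. S F \<in> fock) \<and>
    (\<forall>F\<in>fock. \<forall>G\<in>fock. S (\<lambda>z. F z + G z) = (\<lambda>z. S F z + S G z)) \<and>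
    (\<forall>c. \<forall>F\<in>fock. S (\<lambda>z. c * F z) = (\<lambda>z. c * S F z)) \<and>
    (\<exists>K. \<forall>F\<in>fock. L2_norm fock_measure (S F) \<le> K * L2_norm fock_measure F)"

text \<open>\<open>rho_i b\<close> is the operator \<open>\<rho>(ib)\<close>.\<close>

definition rho_i :: "real ^ 'n \<Rightarrow> (complex ^ 'n \<Rightarrow> complex) \<Rightarrow> complex ^ 'n \<Rightarrow> complex"
  where "rho_i b F = (\<lambda>z. F (z + \<i> *s of_real_vec b)
    * exp (1 / 2 * cdot (\<i> *s of_real_vec b) z) * exp (complex_of_real (- (norm b)\<^sup>2 / 4)))"

text \<open>The constant \<open>\<pi>\<^bsup>-n/4\<^esup>\<close> is the positive one that makes the transform unitary: for
  \<open>z = x + iy\<close> the modulus of the kernel times \<open>exp (- |z|\<^sup>2 / 4)\<close> is \<open>exp (- |x - u|\<^sup>2 / 2)\<close>, so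
  Plancherel in \<open>y\<close> (whose factor \<open>(2 \<pi>)\<^bsup>n\<^esup>\<close> cancels against the measure) followed by
  integration in \<open>x\<close> gives the squared norm \<open>\<pi>\<^bsup>n/2\<^esup> \<parallel>f\<parallel>\<^sup>2\<close> without it.\<close>

definition bargmann :: "(real ^ 'n \<Rightarrow> complex) \<Rightarrow> complex ^ 'n \<Rightarrow> complex"
  where "bargmann f = (\<lambda>z. complex_of_real (pi powr (- real CARD('n) / 4))
    * (exp (- cdot z z / 4)
      * (LINT u|lborel. f u * exp (complex_of_real (- (norm u)\<^sup>2 / 2)) * exp (cdot (of_real_vec u) z))))"

text \<open>The adjoint of the Bargmann transform; its value is determined up to almost everywhere
  equality, and the choice picks a representative.\<close>

definition bargmann_adj :: "(complex ^ 'n \<Rightarrow> complex) \<Rightarrow> real ^ 'n \<Rightarrow> complex"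
  where "bargmann_adj F = (SOME f. f \<in> L2 lborel \<and>
    (\<forall>g\<in>L2 lborel. L2_inner fock_measure (bargmann g) F = L2_inner lborel g f))"

end

theory Submission
  imports Defs "HOL-Probability.Characteristic_Functions" "HOL-Complex_Analysis.Cauchy_Integral_Formula"
begin

text \<open>
  Conjugation by the Bargmann transform \<open>B\<close> turns \<open>rho_i b\<close> into multiplication by the
  character \<open>u \<mapsto> exp (\<i> b \<cdot> u)\<close> (lemma \<open>rho_i_bargmann\<close>).  A bounded operator on
  \<open>L\<^sup>2\<close> that commutes with all characters is multiplication by a bounded function: it is
  determined by its value \<open>\<psi>\<close> on one nowhere vanishing function, here the Gaussian \<open>k\<close>,
  because the products of \<open>k\<close> with trigonometric polynomials are dense; the multiplier is
  \<open>\<psi> / k\<close>, and boundedness of the operator forces \<open>\<bar>\<psi>\<bar> \<le> K \<bar>k\<bar>\<close> almost everywhere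
  (lemma \<open>commuting_imp_multiplier\<close>).  Conversely multiplications commute with each other
  (lemma \<open>multiplier_imp_commuting\<close>).

  This needs \<open>B\<close> to be a surjective isometry with inverse \<open>bargmann_adj\<close>.  The proof goes
  through reproducing kernels.  The value \<open>B f z\<close> is the inner
  product of \<open>f\<close> with a Gaussian \<open>coherent z\<close>, and a Gaussian integral shows that \<open>B\<close> maps
  \<open>coherent w\<close> to \<open>fock_kernel w\<close>.  The latter is the reproducing kernel of the Fock space
  (theorem \<open>fock_reproducing\<close>): the Gaussian measure is invariant under multiplication by
  complex numbers of modulus one, so integrating an entire function against it gives the value at
  \<open>0\<close>, by Cauchy's formula on each complex line through \<open>0\<close>.  Hence \<open>B\<close> preserves inner
  products of coherent states.  The modulated Gaussians are coherent states, and their span is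
  dense, so \<open>B\<close> is isometric on all of \<open>L\<^sup>2\<close> (theorem \<open>bargmann_isometry\<close>).

  For the inverse, the integral defining the adjoint of \<open>B\<close> converges absolutely on functions
  cut off outside a ball, and is norm decreasing there because \<open>B\<close> is isometric.  Completeness
  of \<open>L\<^sup>2\<close> yields the adjoint in general (theorem \<open>bargmann_adjoint_exists\<close>), and testing
  against coherent states shows that it is a right inverse on the Fock space
  (theorem \<open>bargmann_bargmann_adj\<close>).
\<close>

section \<open>The seminormed space of square integrable functions\<close>

text \<open>Functions that agree almost everywhere are not identified, so \<open>L2_norm\<close> is only a seminorm.
  Limits in \<open>L\<^sup>2\<close> are therefore expressed by the norms of differences tending to zero.\<close>

lemma L2_measurable [measurable_dest]: "f \<in> L2 M \<Longrightarrow> f \<in> borel_measurable M"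
  by (simp add: L2_def)

lemma L2_integrable_sq: "f \<in> L2 M \<Longrightarrow> integrable M (\<lambda>x. (norm (f x))\<^sup>2)"
  by (simp add: L2_def)

lemma L2_bound:
  assumes "f \<in> borel_measurable M" "integrable M h" "AE x in M. (norm (f x))\<^sup>2 \<le> h x"
  shows "f \<in> L2 M"
  using assms unfolding L2_def
  by (auto intro!: Bochner_Integration.integrable_bound[OF assms(2)])

lemma L2_scale: "f \<in> L2 M \<Longrightarrow> (\<lambda>x. c * f x) \<in> L2 M"
  by (auto simp: L2_def norm_mult power_mult_distrib)

lemma L2_add:
  assumes "f \<in> L2 M" "g \<in> L2 M" shows "(\<lambda>x. f x + g x) \<in> L2 M"
proof (rule L2_bound)
  show "integrable M (\<lambda>x. 2 * (norm (f x))\<^sup>2 + 2 * (norm (g x))\<^sup>2)"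
    using assms by (intro Bochner_Integration.integrable_add integrable_mult_right L2_integrable_sq)
  have "(norm (f x + g x))\<^sup>2 \<le> 2 * (norm (f x))\<^sup>2 + 2 * (norm (g x))\<^sup>2" for x
  proof -
    have "(norm (f x + g x))\<^sup>2 \<le> (norm (f x) + norm (g x))\<^sup>2"
      by (intro power_mono norm_triangle_ineq) auto
    also have "\<dots> \<le> 2 * (norm (f x))\<^sup>2 + 2 * (norm (g x))\<^sup>2"
      using sum_squares_bound[of "norm (f x)" "norm (g x)"] by (simp add: power2_sum)
    finally show ?thesis .
  qed
  then show "AE x in M. (norm (f x + g x))\<^sup>2 \<le> 2 * (norm (f x))\<^sup>2 + 2 * (norm (g x))\<^sup>2" by simp
qed (use assms in measurable)

lemma L2_diff:
  assumes "f \<in> L2 M" "g \<in> L2 M" shows "(\<lambda>x. f x - g x) \<in> L2 M"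
  using L2_add[OF assms(1) L2_scale[OF assms(2), of "-1"]] by simp

lemma L2_bounded_mult:
  assumes f: "f \<in> L2 M" and q: "q \<in> borel_measurable M" "AE x in M. norm (q x) \<le> C"
  shows "(\<lambda>x. q x * f x) \<in> L2 M"
proof (rule L2_bound)
  show "integrable M (\<lambda>x. C\<^sup>2 * (norm (f x))\<^sup>2)" by (intro integrable_mult_right L2_integrable_sq f)
  show "AE x in M. (norm (q x * f x))\<^sup>2 \<le> C\<^sup>2 * (norm (f x))\<^sup>2"
    using q(2) by eventually_elim
      (auto simp: norm_mult power_mult_distrib intro!: mult_right_mono power_mono)
qed (use f q in measurable)

lemma L2_prod_integrable:
  assumes f: "f \<in> L2 M" and g: "g \<in> L2 M"
  shows "integrable M (\<lambda>x. f x * g x)"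
proof (rule Bochner_Integration.integrable_bound)
  show "integrable M (\<lambda>x. (norm (f x))\<^sup>2 + (norm (g x))\<^sup>2)"
    using f g by (intro Bochner_Integration.integrable_add L2_integrable_sq)
  have "norm (f x * g x) \<le> norm ((norm (f x))\<^sup>2 + (norm (g x))\<^sup>2)" for x
    using sum_squares_bound[of "norm (f x)" "norm (g x)"]
      mult_nonneg_nonneg[OF norm_ge_zero norm_ge_zero, of "f x" "g x"]
    by (simp add: norm_mult, linarith)
  then show "AE x in M. norm (f x * g x) \<le> norm ((norm (f x))\<^sup>2 + (norm (g x))\<^sup>2)" by simp
qed (use f g in measurable)

lemma cnj_borel_measurable [measurable]: "cnj \<in> borel_measurable borel"
  by (intro borel_measurable_continuous_onI continuous_intros)

lemma L2_cnj:
  assumes "f \<in> L2 M" shows "(\<lambda>x. cnj (f x)) \<in> L2 M"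
proof (rule L2_bound)
  show "integrable M (\<lambda>x. (norm (f x))\<^sup>2)" using assms by (rule L2_integrable_sq)
  show "(\<lambda>x. cnj (f x)) \<in> borel_measurable M" using assms by measurable
qed simp

lemma L2_inner_integrable:
  "f \<in> L2 M \<Longrightarrow> g \<in> L2 M \<Longrightarrow> integrable M (\<lambda>x. f x * cnj (g x))"
  by (intro L2_prod_integrable L2_cnj)

lemma L2_inner_add:
  assumes "f \<in> L2 M" "g \<in> L2 M" "h \<in> L2 M"
  shows "L2_inner M (\<lambda>x. f x + g x) h = L2_inner M f h + L2_inner M g h"
    "L2_inner M h (\<lambda>x. f x + g x) = L2_inner M h f + L2_inner M h g"
  using assms by (simp_all add: L2_inner_def distrib_left distrib_right
      Bochner_Integration.integral_add L2_inner_integrable)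

lemma L2_inner_diff:
  assumes "f \<in> L2 M" "g \<in> L2 M" "h \<in> L2 M"
  shows "L2_inner M (\<lambda>x. f x - g x) h = L2_inner M f h - L2_inner M g h"
    "L2_inner M h (\<lambda>x. f x - g x) = L2_inner M h f - L2_inner M h g"
  using assms by (simp_all add: L2_inner_def left_diff_distrib right_diff_distrib
      Bochner_Integration.integral_diff L2_inner_integrable)

lemma L2_inner_scale:
  "L2_inner M (\<lambda>x. c * f x) h = c * L2_inner M f h"
  "L2_inner M h (\<lambda>x. c * f x) = cnj c * L2_inner M h f"
proof -
  show "L2_inner M (\<lambda>x. c * f x) h = c * L2_inner M f h"
    by (simp add: L2_inner_def mult.assoc)
  have "L2_inner M h (\<lambda>x. c * f x) = (LINT x|M. cnj c * (h x * cnj (f x)))"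
    by (simp add: L2_inner_def mult_ac)
  then show "L2_inner M h (\<lambda>x. c * f x) = cnj c * L2_inner M h f"
    by (simp add: L2_inner_def)
qed

lemma L2_inner_commute: "L2_inner M g f = cnj (L2_inner M f g)"
  by (simp add: L2_inner_def Bochner_Integration.integral_cnj[symmetric] mult.commute del: Bochner_Integration.integral_cnj)

lemma L2_norm_nonneg: "0 \<le> L2_norm M f"
  by (simp add: L2_norm_def)

lemma L2_norm_sq: "(L2_norm M f)\<^sup>2 = (LINT x|M. (norm (f x))\<^sup>2)"
  by (simp add: L2_norm_def)

lemma L2_inner_self: "L2_inner M f f = of_real ((L2_norm M f)\<^sup>2)"
proof -
  have "L2_inner M f f = (LINT x|M. complex_of_real ((norm (f x))\<^sup>2))"
    unfolding L2_inner_def by (simp only: complex_norm_square)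
  then show ?thesis by (simp only: L2_norm_sq integral_complex_of_real)
qed

lemma L2_norm_scale: "L2_norm M (\<lambda>x. c * f x) = norm c * L2_norm M f"
  by (simp add: L2_norm_def norm_mult power_mult_distrib real_sqrt_mult)

lemma L2_norm_minus: "L2_norm M (\<lambda>x. f x - g x) = L2_norm M (\<lambda>x. g x - f x)"
  by (simp add: L2_norm_def norm_minus_commute)

lemma L2_Cauchy_Schwarz_abs:
  assumes f: "f \<in> L2 M" and g: "g \<in> L2 M"
  shows "(LINT x|M. norm (f x) * norm (g x)) \<le> L2_norm M f * L2_norm M g"
proof (rule power2_le_imp_le)
  have int: "integrable M (\<lambda>x. norm (f x) * norm (g x))"
    using integrable_norm[OF L2_prod_integrable[OF f g]] by (simp add: norm_mult)
  have [measurable]: "f \<in> borel_measurable M" "g \<in> borel_measurable M" using f g by auto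
  have "ennreal ((LINT x|M. norm (f x) * norm (g x))\<^sup>2)
      = (\<integral>\<^sup>+x. ennreal (norm (f x)) * ennreal (norm (g x)) \<partial>M)\<^sup>2"
    by (simp add: nn_integral_eq_integral[OF int] ennreal_mult[symmetric] ennreal_power)
  also have "\<dots> \<le> (\<integral>\<^sup>+x. ennreal (norm (f x)) ^ 2 \<partial>M) * (\<integral>\<^sup>+x. ennreal (norm (g x)) ^ 2 \<partial>M)"
    by (rule Cauchy_Schwarz_nn_integral) auto
  also have "\<dots> = ennreal ((L2_norm M f * L2_norm M g)\<^sup>2)"
    using nn_integral_eq_integral[OF L2_integrable_sq[OF f]] nn_integral_eq_integral[OF L2_integrable_sq[OF g]]
    by (simp add: ennreal_power L2_norm_sq power_mult_distrib ennreal_mult)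
  finally show "(LINT x|M. norm (f x) * norm (g x))\<^sup>2 \<le> (L2_norm M f * L2_norm M g)\<^sup>2" by simp
qed (simp add: L2_norm_nonneg)

lemma L2_Cauchy_Schwarz:
  assumes "f \<in> L2 M" "g \<in> L2 M"
  shows "norm (L2_inner M f g) \<le> L2_norm M f * L2_norm M g"
proof -
  have "norm (L2_inner M f g) \<le> (LINT x|M. norm (f x * cnj (g x)))"
    unfolding L2_inner_def by (rule integral_norm_bound)
  also have "\<dots> = (LINT x|M. norm (f x) * norm (g x))" by (simp add: norm_mult)
  finally show ?thesis using L2_Cauchy_Schwarz_abs[OF assms] by simp
qed

lemma L2_norm_triangle:
  assumes f: "f \<in> L2 M" and g: "g \<in> L2 M"
  shows "L2_norm M (\<lambda>x. f x + g x) \<le> L2_norm M f + L2_norm M g"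
proof (rule power2_le_imp_le)
  let ?h = "\<lambda>x. f x + g x"
  have re: "(L2_norm M k)\<^sup>2 = Re (L2_inner M k k)" for k by (simp add: L2_inner_self del: of_real_power)
  have "(L2_norm M ?h)\<^sup>2 = (L2_norm M f)\<^sup>2 + (L2_norm M g)\<^sup>2 + 2 * Re (L2_inner M f g)"
    using f g by (simp only: re L2_inner_add L2_add L2_inner_commute[of M g f]) simp
  moreover have "Re (L2_inner M f g) \<le> L2_norm M f * L2_norm M g"
    using L2_Cauchy_Schwarz[OF f g] complex_Re_le_cmod[of "L2_inner M f g"] by linarith
  ultimately show "(L2_norm M ?h)\<^sup>2 \<le> (L2_norm M f + L2_norm M g)\<^sup>2"
    by (simp add: power2_sum)
qed (simp add: L2_norm_nonneg)

lemma L2_norm_triangle_diff: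
  assumes "f \<in> L2 M" "g \<in> L2 M" "h \<in> L2 M"
  shows "L2_norm M (\<lambda>x. f x - h x) \<le> L2_norm M (\<lambda>x. f x - g x) + L2_norm M (\<lambda>x. g x - h x)"
  using L2_norm_triangle[OF L2_diff[OF assms(1,2)] L2_diff[OF assms(2,3)]] by simp

lemma L2_norm_diff_abs:
  assumes f: "f \<in> L2 M" and g: "g \<in> L2 M"
  shows "\<bar>L2_norm M f - L2_norm M g\<bar> \<le> L2_norm M (\<lambda>x. f x - g x)"
  using L2_norm_triangle[OF L2_diff[OF f g] g] L2_norm_triangle[OF L2_diff[OF g f] f]
  by (simp add: L2_norm_minus[of M f g])

lemma L2_norm_tendsto:
  assumes "f \<in> L2 M" "\<And>n. p n \<in> L2 M" "(\<lambda>n. L2_norm M (\<lambda>x. p n x - f x)) \<longlonglongrightarrow> 0"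
  shows "(\<lambda>n. L2_norm M (p n)) \<longlonglongrightarrow> L2_norm M f"
proof (rule LIM_zero_cancel, rule Lim_null_comparison[OF _ assms(3)])
  show "\<forall>\<^sub>F n in sequentially. norm (L2_norm M (p n) - L2_norm M f) \<le> L2_norm M (\<lambda>x. p n x - f x)"
    using L2_norm_diff_abs[OF assms(2,1)] by simp
qed

lemma L2_inner_tendsto:
  assumes f: "f \<in> L2 M" and p: "\<And>n. p n \<in> L2 M" and g: "g \<in> L2 M"
    and lim: "(\<lambda>n. L2_norm M (\<lambda>x. p n x - f x)) \<longlonglongrightarrow> 0"
  shows "(\<lambda>n. L2_inner M (p n) g) \<longlonglongrightarrow> L2_inner M f g"
    "(\<lambda>n. L2_inner M g (p n)) \<longlonglongrightarrow> L2_inner M g f"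
proof -
  show 1: "(\<lambda>n. L2_inner M (p n) g) \<longlonglongrightarrow> L2_inner M f g"
  proof (rule LIM_zero_cancel, rule Lim_null_comparison)
    show "(\<lambda>n. L2_norm M (\<lambda>x. p n x - f x) * L2_norm M g) \<longlonglongrightarrow> 0"
      using tendsto_mult_left_zero[OF lim] by simp
    show "\<forall>\<^sub>F n in sequentially. norm (L2_inner M (p n) g - L2_inner M f g) \<le> L2_norm M (\<lambda>x. p n x - f x) * L2_norm M g"
      using L2_Cauchy_Schwarz[OF L2_diff[OF p f] g] by (simp add: L2_inner_diff f g p)
  qed
  show "(\<lambda>n. L2_inner M g (p n)) \<longlonglongrightarrow> L2_inner M g f"
    using tendsto_cnj[OF 1] by (simp add: L2_inner_commute[symmetric])
qed

lemma L2_norm_zero_AE: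
  assumes f: "f \<in> L2 M" and 0: "L2_norm M f = 0"
  shows "AE x in M. f x = 0"
proof -
  have "(LINT x|M. (norm (f x))\<^sup>2) = 0" using 0 L2_norm_sq[of M f] by simp
  then have "AE x in M. (norm (f x))\<^sup>2 = 0"
    using integral_nonneg_eq_0_iff_AE[OF L2_integrable_sq[OF f]] by simp
  then show ?thesis by simp
qed

lemma L2_norm_mono:
  assumes h: "h \<in> L2 M" and f: "f \<in> borel_measurable M" and le: "\<And>x. norm (f x) \<le> norm (h x)"
  shows "f \<in> L2 M" "L2_norm M f \<le> L2_norm M h"
proof -
  show *: "f \<in> L2 M"
    by (rule L2_bound[OF f L2_integrable_sq[OF h]]) (simp add: le power_mono)
  have "(LINT x|M. (norm (f x))\<^sup>2) \<le> (LINT x|M. (norm (h x))\<^sup>2)"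
    using L2_integrable_sq[OF *] L2_integrable_sq[OF h] by (rule integral_mono) (simp add: le power_mono)
  then show "L2_norm M f \<le> L2_norm M h" by (simp add: L2_norm_def)
qed

lemma L2_dominated:
  assumes f: "f \<in> borel_measurable M" and p: "\<And>n. p n \<in> borel_measurable M"
    and lim: "AE x in M. (\<lambda>n. p n x) \<longlonglongrightarrow> f x"
    and h: "integrable M h" and b: "\<And>n. AE x in M. (norm (p n x - f x))\<^sup>2 \<le> h x"
  shows "(\<lambda>n. L2_norm M (\<lambda>x. p n x - f x)) \<longlonglongrightarrow> 0"
proof -
  have "(\<lambda>n. LINT x|M. (norm (p n x - f x))\<^sup>2) \<longlonglongrightarrow> (LINT x|M. 0)"
  proof (rule integral_dominated_convergence[OF _ _ h])
    show "AE x in M. (\<lambda>i. (norm (p i x - f x))\<^sup>2) \<longlonglongrightarrow> 0"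
      using lim
    proof eventually_elim
      case (elim x)
      then have "(\<lambda>i. norm (p i x - f x)) \<longlonglongrightarrow> 0" by (intro tendsto_norm_zero LIM_zero)
      from tendsto_power[OF this, of 2] show ?case by simp
    qed
  qed (use f p b in auto)
  then have "(\<lambda>n. sqrt (LINT x|M. (norm (p n x - f x))\<^sup>2)) \<longlonglongrightarrow> sqrt 0"
    by (intro tendsto_real_sqrt) simp
  then show ?thesis by (simp add: L2_norm_def)
qed

lemma L2_norm_eq_nn:
  assumes "f \<in> L2 M"
  shows "(\<integral>\<^sup>+x. ennreal ((norm (f x))\<^sup>2) \<partial>M) = ennreal ((L2_norm M f)\<^sup>2)"
  using nn_integral_eq_integral[OF L2_integrable_sq[OF assms]] by (simp add: L2_norm_sq)

lemma L2_nnI: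
  assumes [measurable]: "f \<in> borel_measurable M"
    and le: "(\<integral>\<^sup>+x. ennreal ((norm (f x))\<^sup>2) \<partial>M) \<le> ennreal (C\<^sup>2)" and "0 \<le> C"
  shows "f \<in> L2 M" "L2_norm M f \<le> C"
proof -
  have "(\<integral>\<^sup>+x. ennreal ((norm (f x))\<^sup>2) \<partial>M) < \<infinity>"
    using le by (rule le_less_trans) simp
  then show *: "f \<in> L2 M" by (auto simp: L2_def integrable_iff_bounded)
  show "L2_norm M f \<le> C"
  proof (rule power2_le_imp_le)
    have "ennreal ((L2_norm M f)\<^sup>2) \<le> ennreal (C\<^sup>2)" using le unfolding L2_norm_eq_nn[OF *] .
    then show "(L2_norm M f)\<^sup>2 \<le> C\<^sup>2" by (simp only: ennreal_le_iff zero_le_power2)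
  qed fact
qed

lemma L2_Fatou:
  assumes f: "f \<in> borel_measurable M" and p: "\<And>n. p n \<in> L2 M"
    and lim: "AE x in M. (\<lambda>n. p n x) \<longlonglongrightarrow> f x" and C: "\<And>n. L2_norm M (p n) \<le> C n" "C \<longlonglongrightarrow> c"
  shows "f \<in> L2 M" "L2_norm M f \<le> c"
proof -
  have [measurable]: "f \<in> borel_measurable M" "\<And>n. p n \<in> borel_measurable M" using f p by auto
  have C0: "0 \<le> C n" for n using C(1)[of n] L2_norm_nonneg[of M "p n"] by linarith
  then have c0: "0 \<le> c" using LIMSEQ_le_const[OF C(2), of 0] by auto
  have "(\<integral>\<^sup>+x. ennreal ((norm (f x))\<^sup>2) \<partial>M) = (\<integral>\<^sup>+x. liminf (\<lambda>n. ennreal ((norm (p n x))\<^sup>2)) \<partial>M)"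
  proof (rule nn_integral_cong_AE, use lim in eventually_elim)
    case (elim x)
    then have "(\<lambda>n. ennreal ((norm (p n x))\<^sup>2)) \<longlonglongrightarrow> ennreal ((norm (f x))\<^sup>2)"
      by (intro tendsto_intros)
    then show ?case by (intro lim_imp_Liminf[symmetric]) simp_all
  qed
  also have "\<dots> \<le> liminf (\<lambda>n. (\<integral>\<^sup>+x. ennreal ((norm (p n x))\<^sup>2) \<partial>M))"
    by (rule nn_integral_liminf) auto
  also have "\<dots> \<le> liminf (\<lambda>n. ennreal ((C n)\<^sup>2))"
  proof (rule Liminf_mono, rule always_eventually, rule allI)
    fix n
    show "(\<integral>\<^sup>+x. ennreal ((norm (p n x))\<^sup>2) \<partial>M) \<le> ennreal ((C n)\<^sup>2)"
      unfolding L2_norm_eq_nn[OF p]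
      by (intro ennreal_leI power_mono C L2_norm_nonneg)
  qed
  also have "\<dots> = ennreal (c\<^sup>2)"
    by (intro lim_imp_Liminf tendsto_intros C) simp
  finally have *: "(\<integral>\<^sup>+x. ennreal ((norm (f x))\<^sup>2) \<partial>M) \<le> ennreal (c\<^sup>2)" .
  show "f \<in> L2 M" "L2_norm M f \<le> c" using L2_nnI[OF f * c0] by auto
qed

lemma L2_bounded_mult_tendsto:
  assumes p: "\<And>n. p n \<in> L2 M" "q \<in> L2 M" "(\<lambda>n. L2_norm M (\<lambda>x. p n x - q x)) \<longlonglongrightarrow> 0"
    and r: "r \<in> borel_measurable M" "\<And>x. norm (r x) \<le> C"
  shows "(\<lambda>n. L2_norm M (\<lambda>x. r x * p n x - r x * q x)) \<longlonglongrightarrow> 0"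
proof (rule Lim_null_comparison[OF always_eventually tendsto_mult_right_zero[OF p(3), of C]], rule allI)
  fix n
  have C: "0 \<le> C" using r(2)[of undefined] norm_ge_zero order_trans by blast
  have "L2_norm M (\<lambda>x. r x * (p n x - q x)) \<le> C * L2_norm M (\<lambda>x. p n x - q x)"
  proof (rule L2_nnI)
    have [measurable]: "p n \<in> borel_measurable M" "q \<in> borel_measurable M" using p by auto
    note r(1)[measurable]
    show "(\<lambda>x. r x * (p n x - q x)) \<in> borel_measurable M" by measurable
    have "(\<integral>\<^sup>+x. ennreal ((norm (r x * (p n x - q x)))\<^sup>2) \<partial>M)
        \<le> (\<integral>\<^sup>+x. ennreal (C\<^sup>2) * ennreal ((norm (p n x - q x))\<^sup>2) \<partial>M)"
      using r(2) by (intro nn_integral_mono)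
        (auto simp: ennreal_mult[symmetric] norm_mult power_mult_distrib intro!: ennreal_leI mult_right_mono power_mono)
    also have "\<dots> = ennreal ((C * L2_norm M (\<lambda>x. p n x - q x))\<^sup>2)"
      by (subst nn_integral_cmult) (auto simp: L2_norm_eq_nn[OF L2_diff[OF p(1,2)]] ennreal_mult power_mult_distrib)
    finally show "(\<integral>\<^sup>+x. ennreal ((norm (r x * (p n x - q x)))\<^sup>2) \<partial>M) \<le> ennreal ((C * L2_norm M (\<lambda>x. p n x - q x))\<^sup>2)" .
  qed (use C in \<open>simp add: L2_norm_nonneg\<close>)
  then show "norm (L2_norm M (\<lambda>x. r x * p n x - r x * q x)) \<le> C * L2_norm M (\<lambda>x. p n x - q x)"
    by (simp add: L2_norm_nonneg right_diff_distrib)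
qed

text \<open>The theorem of Riesz and Fischer.  Along a subsequence whose \<open>k\<close>-th increment has norm at most
  \<open>2\<^bsup>-k\<^esup>\<close> the functions converge almost everywhere, and Fatou's lemma bounds the distance to
  the pointwise limit.\<close>

lemma L2_complete:
  assumes f: "\<And>n. f n \<in> L2 M"
    and cauchy: "\<And>e. e > 0 \<Longrightarrow> \<exists>N. \<forall>i\<ge>N. \<forall>j\<ge>N. L2_norm M (\<lambda>x. f i x - f j x) \<le> e"
  shows "\<exists>g\<in>L2 M. (\<lambda>n. L2_norm M (\<lambda>x. f n x - g x)) \<longlonglongrightarrow> 0"
proof -
  have [measurable]: "f n \<in> borel_measurable M" for n using f by auto
  obtain N where N: "\<And>k i j. i \<ge> N k \<Longrightarrow> j \<ge> N k \<Longrightarrow> L2_norm M (\<lambda>x. f i x - f j x) \<le> (1/2) ^ k"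
  proof -
    have "\<forall>k. \<exists>N. \<forall>i\<ge>N. \<forall>j\<ge>N. L2_norm M (\<lambda>x. f i x - f j x) \<le> (1/2) ^ k"
      by (intro allI cauchy) simp
    then show thesis using that by metis
  qed
  define r where "r k = (\<Sum>i\<le>k. N i)" for k
  have r_ge: "r k \<ge> N k" for k unfolding r_def by (rule member_le_sum) auto
  have r_mono: "r k \<le> r (Suc k)" for k by (simp add: r_def)
  define g where "g k x = f (r (Suc k)) x - f (r k) x" for k x
  have gL: "g k \<in> L2 M" for k unfolding g_def by (intro L2_diff f)
  have gn: "(\<integral>\<^sup>+x. ennreal ((norm (g k x))\<^sup>2) \<partial>M) \<le> ennreal ((1/4) ^ k)" for k
  proof -
    have "L2_norm M (g k) \<le> (1/2) ^ k"
      unfolding g_def using N[of k "r (Suc k)" "r k"] r_ge[of k] r_mono[of k] by simp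
    then have "(L2_norm M (g k))\<^sup>2 \<le> ((1/2) ^ k)\<^sup>2" by (intro power_mono L2_norm_nonneg)
    also have "\<dots> = (1/4) ^ k" by (simp add: power2_eq_square flip: power_mult_distrib)
    finally show ?thesis unfolding L2_norm_eq_nn[OF gL] by (rule ennreal_leI)
  qed
  have [measurable]: "g k \<in> borel_measurable M" for k using gL by auto
  \<comment> \<open>The weights \<open>2^k\<close> make the summability of the squares imply that of the terms.\<close>
  have "(\<integral>\<^sup>+x. (\<Sum>k. ennreal (2 ^ k * (norm (g k x))\<^sup>2)) \<partial>M) = (\<Sum>k. \<integral>\<^sup>+x. ennreal (2 ^ k * (norm (g k x))\<^sup>2) \<partial>M)"
    by (rule nn_integral_suminf) auto
  also have "\<dots> \<le> (\<Sum>k. ennreal ((1/2) ^ k))"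
  proof (rule suminf_le)
    fix k
    have "(\<integral>\<^sup>+x. ennreal (2 ^ k * (norm (g k x))\<^sup>2) \<partial>M) = ennreal (2 ^ k) * (\<integral>\<^sup>+x. ennreal ((norm (g k x))\<^sup>2) \<partial>M)"
      by (subst nn_integral_cmult[symmetric]) (auto simp: ennreal_mult)
    also have "\<dots> \<le> ennreal (2 ^ k) * ennreal ((1/4) ^ k)" by (intro mult_left_mono gn) simp
    also have "\<dots> = ennreal ((1/2) ^ k)"
      by (simp add: ennreal_mult[symmetric] power_mult_distrib[symmetric])
    finally show "(\<integral>\<^sup>+x. ennreal (2 ^ k * (norm (g k x))\<^sup>2) \<partial>M) \<le> ennreal ((1/2) ^ k)" .
  qed auto
  also have "\<dots> = ennreal (\<Sum>k. (1/2) ^ k)"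
    by (intro suminf_ennreal2) (auto intro: summable_geometric)
  finally have "(\<integral>\<^sup>+x. (\<Sum>k. ennreal (2 ^ k * (norm (g k x))\<^sup>2)) \<partial>M) < \<infinity>"
    by (rule le_less_trans) simp
  then have "AE x in M. (\<Sum>k. ennreal (2 ^ k * (norm (g k x))\<^sup>2)) \<noteq> \<infinity>"
    by (intro nn_integral_PInf_AE) auto
  then have conv: "AE x in M. convergent (\<lambda>k. f (r k) x)"
  proof eventually_elim
    case (elim x)
    then have "summable (\<lambda>k. 2 ^ k * (norm (g k x))\<^sup>2)"
      by (intro summable_suminf_not_top) auto
    then have "Bseq (\<lambda>k. 2 ^ k * (norm (g k x))\<^sup>2)"
      by (intro convergent_imp_Bseq convergentI[OF summable_LIMSEQ_zero])
    then obtain K where "\<forall>k. norm (2 ^ k * (norm (g k x))\<^sup>2) \<le> K" by (rule BseqE)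
    then have K: "2 ^ k * (norm (g k x))\<^sup>2 \<le> K" for k by (simp add: abs_mult)
    have K0: "0 \<le> K" using K[of 0] by (rule order_trans[rotated]) simp
    have gb: "norm (g k x) \<le> sqrt K * (1 / sqrt 2) ^ k" for k
    proof (rule power2_le_imp_le)
      have "((1 / sqrt 2) ^ k)\<^sup>2 = (1/2 :: real) ^ k"
        by (simp add: power2_eq_square flip: power_mult_distrib)
      then show "(norm (g k x))\<^sup>2 \<le> (sqrt K * (1 / sqrt 2) ^ k)\<^sup>2"
        using K[of k] K0 by (simp add: power_mult_distrib power_one_over field_simps)
    qed (use K0 in simp)
    have "summable (\<lambda>k. sqrt K * (1 / sqrt 2) ^ k)"
      by (intro summable_mult summable_geometric) auto
    then have "summable (\<lambda>k. g k x)"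
      by (rule summable_comparison_test'[where N = 0]) (rule gb)
    then have "(\<lambda>n. f (r 0) x + (\<Sum>k<n. g k x)) \<longlonglongrightarrow> f (r 0) x + (\<Sum>k. g k x)"
      by (intro tendsto_add tendsto_const summable_LIMSEQ)
    moreover have "f (r 0) x + (\<Sum>k<n. g k x) = f (r n) x" for n
      using sum_lessThan_telescope[of "\<lambda>k. f (r k) x" n] by (simp add: g_def)
    ultimately show ?case by (auto simp: convergent_def)
  qed
  define h where "h x = lim (\<lambda>k. f (r k) x)" for x
  have h [measurable]: "h \<in> borel_measurable M" unfolding h_def by measurable
  have lim: "AE x in M. (\<lambda>k. f (r k) x) \<longlonglongrightarrow> h x"
    using conv by eventually_elim (simp add: h_def convergent_LIMSEQ_iff)
  have close: "(\<lambda>x. f n x - h x) \<in> L2 M" "L2_norm M (\<lambda>x. f n x - h x) \<le> (1/2) ^ k" if "n \<ge> N k" for n k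
  proof -
    have ae: "AE x in M. (\<lambda>j. f n x - f (r (j + k)) x) \<longlonglongrightarrow> f n x - h x"
      using lim by eventually_elim (intro tendsto_intros LIMSEQ_ignore_initial_segment)
    have bd: "L2_norm M (\<lambda>x. f n x - f (r (j + k)) x) \<le> (1/2) ^ k" for j
    proof (rule N[OF that])
      have "N k \<le> (\<Sum>i\<le>j + k. N i)" by (rule member_le_sum) auto
      then show "N k \<le> r (j + k)" by (simp add: r_def)
    qed
    have meas: "(\<lambda>x. f n x - h x) \<in> borel_measurable M" by measurable
    show "(\<lambda>x. f n x - h x) \<in> L2 M" "L2_norm M (\<lambda>x. f n x - h x) \<le> (1/2) ^ k"
      by (rule L2_Fatou[OF meas L2_diff[OF f f] ae bd tendsto_const])+
  qed
  have "h \<in> L2 M" using L2_diff[OF f close(1)[OF order_refl], of "N 0" 0] by simp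
  moreover have "(\<lambda>n. L2_norm M (\<lambda>x. f n x - h x)) \<longlonglongrightarrow> 0"
  proof (rule LIMSEQ_I)
    fix e :: real assume "0 < e"
    then obtain k where k: "(1/2) ^ k < e" using real_arch_pow_inv[of e "1/2"] by auto
    show "\<exists>no. \<forall>n\<ge>no. norm (L2_norm M (\<lambda>x. f n x - h x) - 0) < e"
      using le_less_trans[OF close(2) k] by (intro exI[of _ "N k"]) (simp add: L2_norm_nonneg)
  qed
  ultimately show ?thesis by blast
qed

section \<open>Density of the trigonometric polynomials\<close>

text \<open>The complex span of the characters.  The inductive form reduces statements that are additive in
  each polynomial to multiples of single characters.\<close>

inductive_set trig :: "('a::euclidean_space \<Rightarrow> complex) set" where
  trig_cis: "(\<lambda>x. c * cis (b \<bullet> x)) \<in> trig"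
| trig_add: "p \<in> trig \<Longrightarrow> q \<in> trig \<Longrightarrow> (\<lambda>x. p x + q x) \<in> trig"

lemma trig_scale: "p \<in> trig \<Longrightarrow> (\<lambda>x. c * p x) \<in> trig"
proof (induction rule: trig.induct)
  case (trig_cis d b)
  then show ?case using trig.trig_cis[of "c * d" b] by (simp add: mult.assoc)
next
  case (trig_add p q)
  then show ?case using trig.trig_add by (simp add: distrib_left)
qed

lemma trig_cis_mult: "p \<in> trig \<Longrightarrow> (\<lambda>x. cis (b \<bullet> x) * p x) \<in> trig"
proof (induction rule: trig.induct)
  case (trig_cis d a)
  then show ?case using trig.trig_cis[of d "b + a"]
    by (simp add: cis_mult inner_add_left mult.left_commute)
next
  case (trig_add p q)
  then show ?case using trig.trig_add by (simp add: distrib_left)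
qed

lemma cis_borel_measurable [measurable]: "cis \<in> borel_measurable borel"
  by (rule borel_measurable_continuous_onI, rule continuous_on_cis[OF continuous_on_id])

lemma trig_measurable [measurable_dest]: "p \<in> trig \<Longrightarrow> p \<in> borel_measurable borel"
  by (induction rule: trig.induct) auto

lemma trig_bounded: "p \<in> trig \<Longrightarrow> \<exists>C. \<forall>x. norm (p x) \<le> C"
proof (induction rule: trig.induct)
  case (trig_cis c b)
  then show ?case by (intro exI[of _ "norm c"]) (simp add: norm_mult)
next
  case (trig_add p q)
  then obtain C D where "\<And>x. norm (p x) \<le> C" "\<And>x. norm (q x) \<le> D" by blast
  then show ?case by (intro exI[of _ "C + D"]) (metis add_mono norm_triangle_le)
qed

text \<open>The closure of the trigonometric polynomials in \<open>L\<^sup>2\<close> of a finite Borel measure is the whole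
  space, by a monotone class argument.  The closure is stable under multiplication by its
  bounded elements and under bounded pointwise limits, so the sets whose indicators it contains form
  a \<open>\<sigma>\<close>-algebra.  It suffices to produce the half-spaces \<open>{x. x \<bullet> i \<le> a}\<close>, which come from
  functions of \<open>sin (t * (x \<bullet> i)) / t\<close> as \<open>t\<close> tends to \<open>0\<close>.\<close>

locale finite_borel_measure = finite_measure M for M :: "'a::euclidean_space measure" +
  assumes sets_eq [measurable_cong]: "sets M = sets borel"
begin

lemma bounded_L2:
  assumes "q \<in> borel_measurable borel" "\<And>x. norm (q x) \<le> C"
  shows "q \<in> L2 M"
proof (rule L2_bound)
  show "integrable M (\<lambda>x. C\<^sup>2)" by simp
  show "AE x in M. (norm (q x))\<^sup>2 \<le> C\<^sup>2" by (intro AE_I2 power_mono assms(2)) simp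
qed (use assms(1) in measurable)

lemma trig_L2: "p \<in> trig \<Longrightarrow> p \<in> L2 M"
  using bounded_L2[of p] trig_measurable[of p] trig_bounded[of p] by blast

definition trig_closure :: "('a \<Rightarrow> complex) set" where
  "trig_closure = {q \<in> L2 M. \<forall>e>0. \<exists>p\<in>trig. L2_norm M (\<lambda>x. p x - q x) < e}"

lemma closure_L2: "q \<in> trig_closure \<Longrightarrow> q \<in> L2 M"
  by (simp add: trig_closure_def)

lemma closure_sequence:
  assumes "q \<in> trig_closure"
  shows "\<exists>p. (\<forall>n. p n \<in> trig) \<and> (\<lambda>n. L2_norm M (\<lambda>x. p n x - q x)) \<longlonglongrightarrow> 0"
proof -
  have "\<forall>n. \<exists>p\<in>trig. L2_norm M (\<lambda>x. p x - q x) < 1 / real (Suc n)"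
    using assms by (auto simp: trig_closure_def)
  then obtain p where p: "\<And>n. p n \<in> trig" "\<And>n. L2_norm M (\<lambda>x. p n x - q x) < 1 / real (Suc n)"
    by metis
  have "(\<lambda>n. L2_norm M (\<lambda>x. p n x - q x)) \<longlonglongrightarrow> 0"
    by (rule Lim_null_comparison[OF _ LIMSEQ_Suc[OF lim_1_over_n]])
      (use p(2) in \<open>auto simp: L2_norm_nonneg less_imp_le intro!: always_eventually\<close>)
  with p(1) show ?thesis by blast
qed

lemma closure_limit:
  assumes q: "q \<in> L2 M" and p: "\<And>n. p n \<in> trig_closure"
    and lim: "(\<lambda>n. L2_norm M (\<lambda>x. p n x - q x)) \<longlonglongrightarrow> 0"
  shows "q \<in> trig_closure"
  unfolding trig_closure_def
proof (intro CollectI conjI q allI impI)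
  fix e :: real assume e: "0 < e"
  then have "\<forall>\<^sub>F n in sequentially. L2_norm M (\<lambda>x. p n x - q x) < e / 2"
    using lim by (intro order_tendstoD) auto
  then obtain n where n: "L2_norm M (\<lambda>x. p n x - q x) < e / 2"
    by (auto simp: eventually_sequentially)
  obtain r where r: "r \<in> trig" "L2_norm M (\<lambda>x. r x - p n x) < e / 2"
    using p[of n] half_gt_zero[OF e] unfolding trig_closure_def by blast
  have "L2_norm M (\<lambda>x. r x - q x) < e"
    using L2_norm_triangle_diff[OF trig_L2[OF r(1)] closure_L2[OF p] q, of n] n r(2) by simp
  with r(1) show "\<exists>p\<in>trig. L2_norm M (\<lambda>x. p x - q x) < e" by blast
qed

lemma closure_trig: "p \<in> trig \<Longrightarrow> p \<in> trig_closure"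
  unfolding trig_closure_def
proof (intro CollectI conjI allI impI trig_L2)
  fix e :: real assume "p \<in> trig" "0 < e"
  then show "\<exists>q\<in>trig. L2_norm M (\<lambda>x. q x - p x) < e"
    by (intro bexI[where x = p]) (simp_all add: L2_norm_def)
qed

lemma closure_scale:
  assumes q: "q \<in> trig_closure" shows "(\<lambda>x. c * q x) \<in> trig_closure"
proof -
  obtain p where p: "\<And>n. p n \<in> trig" "(\<lambda>n. L2_norm M (\<lambda>x. p n x - q x)) \<longlonglongrightarrow> 0"
    using closure_sequence[OF q] by blast
  show ?thesis
  proof (rule closure_limit[where p = "\<lambda>n x. c * p n x"])
    show "(\<lambda>n. L2_norm M (\<lambda>x. c * p n x - c * q x)) \<longlonglongrightarrow> 0"
      using tendsto_mult_right_zero[OF p(2), of "norm c"]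
      by (simp add: L2_norm_scale right_diff_distrib[symmetric])
  qed (use p q in \<open>auto intro: closure_trig trig_scale L2_scale closure_L2\<close>)
qed

lemma closure_add:
  assumes q: "q \<in> trig_closure" and r: "r \<in> trig_closure"
  shows "(\<lambda>x. q x + r x) \<in> trig_closure"
proof -
  obtain p where p: "\<And>n. p n \<in> trig" "(\<lambda>n. L2_norm M (\<lambda>x. p n x - q x)) \<longlonglongrightarrow> 0"
    using closure_sequence[OF q] by blast
  obtain s where s: "\<And>n. s n \<in> trig" "(\<lambda>n. L2_norm M (\<lambda>x. s n x - r x)) \<longlonglongrightarrow> 0"
    using closure_sequence[OF r] by blast
  show ?thesis
  proof (rule closure_limit[where p = "\<lambda>n x. p n x + s n x"])
    show "(\<lambda>n. L2_norm M (\<lambda>x. p n x + s n x - (q x + r x))) \<longlonglongrightarrow> 0"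
    proof (rule Lim_null_comparison[OF always_eventually tendsto_add_zero[OF p(2) s(2)]], rule allI)
      fix n
      show "norm (L2_norm M (\<lambda>x. p n x + s n x - (q x + r x))) \<le> L2_norm M (\<lambda>x. p n x - q x) + L2_norm M (\<lambda>x. s n x - r x)"
        using L2_norm_triangle[OF L2_diff[OF trig_L2[OF p(1)] closure_L2[OF q]] L2_diff[OF trig_L2[OF s(1)] closure_L2[OF r]], of n n]
        by (simp add: L2_norm_nonneg algebra_simps)
    qed
  qed (use p s q r in \<open>auto intro: closure_trig trig_add L2_add closure_L2\<close>)
qed

lemma closure_trig_mult:
  assumes p: "p \<in> trig" and q: "q \<in> trig_closure"
  shows "(\<lambda>x. p x * q x) \<in> trig_closure"
  using p
proof (induction rule: trig.induct)
  case (trig_cis c b)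
  obtain s where s: "\<And>n. s n \<in> trig" "(\<lambda>n. L2_norm M (\<lambda>x. s n x - q x)) \<longlonglongrightarrow> 0"
    using closure_sequence[OF q] by blast
  have "(\<lambda>x. cis (b \<bullet> x) * q x) \<in> trig_closure"
  proof (rule closure_limit)
    show "(\<lambda>x. cis (b \<bullet> x) * q x) \<in> L2 M"
      by (rule L2_bounded_mult[OF closure_L2[OF q], of _ 1]) auto
    show "(\<lambda>x. cis (b \<bullet> x) * s n x) \<in> trig_closure" for n
      by (intro closure_trig trig_cis_mult s)
    show "(\<lambda>n. L2_norm M (\<lambda>x. cis (b \<bullet> x) * s n x - cis (b \<bullet> x) * q x)) \<longlonglongrightarrow> 0"
      by (rule L2_bounded_mult_tendsto[OF trig_L2[OF s(1)] closure_L2[OF q] s(2), of _ 1]) auto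
  qed
  from closure_scale[OF this, of c] show ?case by (simp add: mult.assoc)
next
  case (trig_add p r)
  then show ?case using closure_add by (simp add: distrib_right)
qed

text \<open>The products with trigonometric polynomials from the preceding lemma are passed to the limit;
  the bound on \<open>q\<close> makes multiplication by \<open>q\<close> continuous.\<close>

lemma closure_mult:
  assumes p: "p \<in> trig_closure" and q: "q \<in> trig_closure" and C: "\<And>x. norm (q x) \<le> C"
  shows "(\<lambda>x. q x * p x) \<in> trig_closure"
proof -
  obtain s where s: "\<And>n. s n \<in> trig" "(\<lambda>n. L2_norm M (\<lambda>x. s n x - p x)) \<longlonglongrightarrow> 0"
    using closure_sequence[OF p] by blast
  have [measurable]: "q \<in> borel_measurable M" using q by (auto dest: closure_L2)
  show ?thesis
  proof (rule closure_limit)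
    show "(\<lambda>x. q x * p x) \<in> L2 M"
      by (rule L2_bounded_mult[OF closure_L2[OF p], of _ C]) (use C in auto)
    show "(\<lambda>x. q x * s n x) \<in> trig_closure" for n
      using closure_trig_mult[OF s(1) q, of n] by (simp add: mult.commute)
    show "(\<lambda>n. L2_norm M (\<lambda>x. q x * s n x - q x * p x)) \<longlonglongrightarrow> 0"
      by (rule L2_bounded_mult_tendsto[OF trig_L2[OF s(1)] closure_L2[OF p] s(2) _ C]) auto
  qed
qed

text \<open>Constants are integrable because the measure is finite, so dominated convergence applies.\<close>

lemma closure_bounded_limit:
  assumes p: "\<And>n. p n \<in> trig_closure" and C: "\<And>n x. norm (p n x) \<le> C"
    and lim: "\<And>x. (\<lambda>n. p n x) \<longlonglongrightarrow> q x"
  shows "q \<in> trig_closure"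
proof (rule closure_limit[OF _ p])
  have [measurable]: "p n \<in> borel_measurable borel" for n
    using L2_measurable[OF closure_L2[OF p[of n]]] measurable_cong_sets[OF sets_eq refl] by blast
  have q[measurable]: "q \<in> borel_measurable borel"
    by (rule borel_measurable_LIMSEQ_metric[OF _ lim]) auto
  have Cq: "norm (q x) \<le> C" for x
    by (rule LIMSEQ_le_const2[OF tendsto_norm[OF lim]]) (use C in blast)
  show "q \<in> L2 M" by (rule bounded_L2[OF q Cq])
  show "(\<lambda>n. L2_norm M (\<lambda>x. p n x - q x)) \<longlonglongrightarrow> 0"
  proof (rule L2_dominated)
    show "integrable M (\<lambda>x. (C + C)\<^sup>2)" by simp
    show "AE x in M. (norm (p n x - q x))\<^sup>2 \<le> (C + C)\<^sup>2" for n
      by (intro AE_I2 power_mono order_trans[OF norm_triangle_ineq4] add_mono C Cq) simp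
  qed (use lim in auto)
qed

text \<open>The function \<open>s x = sin (t * (x \<bullet> i)) / t\<close> is itself a trigonometric polynomial, and its
  values lie in the compact interval \<open>{- 1/t..1/t}\<close>.  The functions of \<open>s\<close> that belong to the
  closure form an algebra, to which the theorem of Stone and Weierstrass applies.\<close>

lemma closure_coordinate_sin:
  assumes t: "0 < t" and f: "continuous_on UNIV f"
  shows "(\<lambda>x. complex_of_real (f (sin (t * (x \<bullet> i)) / t))) \<in> trig_closure"
proof -
  define s where "s x = sin (t * (x \<bullet> i)) / t" for x :: 'a
  define S where "S = {-1/t..1/t}"
  have sS: "s x \<in> S" for x
    using t sin_le_one[of "t * (x \<bullet> i)"] sin_ge_minus_one[of "t * (x \<bullet> i)"]
    by (auto simp: s_def S_def divide_simps)
  define P where "P g \<longleftrightarrow> continuous_on UNIV g \<and> (\<lambda>x. complex_of_real (g (s x))) \<in> trig_closure" for g :: "real \<Rightarrow> real"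
  have bdd: "\<exists>C. \<forall>x. norm (complex_of_real (g (s x))) \<le> C" if "continuous_on UNIV g" for g :: "real \<Rightarrow> real"
  proof -
    have "bounded (g ` S)"
      by (intro compact_imp_bounded compact_continuous_image continuous_on_subset[OF that])
        (auto simp: S_def)
    then show ?thesis using sS by (fastforce simp: bounded_iff)
  qed
  have Pid: "P (\<lambda>y. y)"
  proof -
    have "(\<lambda>x. 1 / (2 * \<i> * t) * cis ((t *\<^sub>R i) \<bullet> x) + - 1 / (2 * \<i> * t) * cis ((- t *\<^sub>R i) \<bullet> x)) \<in> trig_closure"
      by (intro closure_trig trig_add trig_cis)
    moreover have "1 / (2 * \<i> * t) * cis ((t *\<^sub>R i) \<bullet> x) + - 1 / (2 * \<i> * t) * cis ((- t *\<^sub>R i) \<bullet> x) = complex_of_real (s x)" for x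
      using t by (auto simp: s_def complex_eq_iff inner_commute[of i] Re_divide Im_divide field_simps power2_eq_square)
    ultimately show ?thesis by (simp add: P_def)
  qed
  have "\<exists>g. P g \<and> (\<forall>y\<in>S. \<bar>f y - g y\<bar> < 1 / real (Suc n))" for n
  proof (rule Stone_Weierstrass_HOL)
    show "P (\<lambda>x. c)" for c
      using closure_trig[OF trig_cis[of "of_real c" 0]] by (simp add: P_def)
    show "P (\<lambda>x. g x + h x)" if "P g \<and> P h" for g h
      using that closure_add by (auto simp: P_def intro!: continuous_intros)
    show "P (\<lambda>x. g x * h x)" if "P g \<and> P h" for g h
    proof -
      have gh: "continuous_on UNIV g" "continuous_on UNIV h"
        "(\<lambda>x. complex_of_real (g (s x))) \<in> trig_closure" "(\<lambda>x. complex_of_real (h (s x))) \<in> trig_closure"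
        using that by (simp_all add: P_def)
      obtain C where "\<And>x. norm (complex_of_real (g (s x))) \<le> C" using bdd[OF gh(1)] by blast
      from closure_mult[OF gh(4,3) this] show ?thesis
        by (simp add: P_def continuous_on_mult gh)
    qed
    show "\<exists>f. P f \<and> f x \<noteq> f y" if "x \<in> S \<and> y \<in> S \<and> x \<noteq> y" for x y
      using Pid that by blast
    show "continuous_on S f" using f by (rule continuous_on_subset) simp
  qed (auto simp: S_def P_def intro: continuous_on_subset)
  then obtain g where g: "\<And>n. P (g n)" "\<And>n y. y \<in> S \<Longrightarrow> \<bar>f y - g n y\<bar> < 1 / real (Suc n)" by metis
  obtain C where C: "\<And>x. norm (complex_of_real (f (s x))) \<le> C" using bdd[OF f] by blast
  have "(\<lambda>x. complex_of_real (f (s x))) \<in> trig_closure"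
  proof (rule closure_bounded_limit)
    show "(\<lambda>x. complex_of_real (g n (s x))) \<in> trig_closure" for n using g(1) by (simp add: P_def)
    show "norm (complex_of_real (g n (s x))) \<le> C + 1" for n x
    proof -
      have "1 / real (Suc n) \<le> 1" by simp
      then show ?thesis using g(2)[OF sS, of x n] C[of x] unfolding norm_of_real by linarith
    qed
    show "(\<lambda>n. complex_of_real (g n (s x))) \<longlonglongrightarrow> complex_of_real (f (s x))" for x
    proof (rule tendsto_of_real, rule LIM_zero_cancel,
        rule Lim_null_comparison[OF always_eventually LIMSEQ_Suc[OF lim_1_over_n]], rule allI)
      show "norm (g n (s x) - f (s x)) \<le> 1 / real (Suc n)" for n using g(2)[OF sS, of x n] unfolding real_norm_def by linarith
    qed
  qed
  then show ?thesis by (simp add: s_def)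
qed

lemma closure_coordinate:
  assumes f: "continuous_on UNIV f" and C: "\<And>y. \<bar>f y\<bar> \<le> C"
  shows "(\<lambda>x. complex_of_real (f (x \<bullet> i))) \<in> trig_closure"
proof (rule closure_bounded_limit)
  show "(\<lambda>x. complex_of_real (f (sin (1 / real (Suc n) * (x \<bullet> i)) / (1 / real (Suc n))))) \<in> trig_closure" for n
    by (rule closure_coordinate_sin[OF _ f]) simp
  show "norm (complex_of_real (f (sin (1 / real (Suc n) * (x \<bullet> i)) / (1 / real (Suc n))))) \<le> C" for n x
    using C by simp
  fix x
  have "((\<lambda>t. sin (t * (x \<bullet> i)) / t) \<longlongrightarrow> x \<bullet> i) (at 0)"
  proof -
    have "((\<lambda>t. sin (t * (x \<bullet> i))) has_real_derivative cos (0 * (x \<bullet> i)) * (x \<bullet> i)) (at 0)"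
      by (auto intro!: derivative_eq_intros)
    then show ?thesis by (simp add: has_field_derivative_iff)
  qed
  moreover have "filterlim (\<lambda>n. 1 / real (Suc n)) (at 0) sequentially"
    by (rule filterlim_atI[OF LIMSEQ_Suc[OF lim_1_over_n]]) auto
  ultimately have "(\<lambda>n. sin (1 / real (Suc n) * (x \<bullet> i)) / (1 / real (Suc n))) \<longlonglongrightarrow> x \<bullet> i"
    by (rule filterlim_compose)
  then show "(\<lambda>n. complex_of_real (f (sin (1 / real (Suc n) * (x \<bullet> i)) / (1 / real (Suc n))))) \<longlonglongrightarrow> complex_of_real (f (x \<bullet> i))"
    using f by (intro tendsto_of_real isCont_tendsto_compose[where g = f]) (auto simp: continuous_on_eq_continuous_at)
qed

text \<open>The indicator is the limit of the continuous ramps \<open>f n\<close>, which for \<open>n > 0\<close> fall from \<open>1\<close> to \<open>0\<close> on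
  the interval from \<open>a\<close> to \<open>a + 1/n\<close>.\<close>

lemma closure_halfspace: "(\<lambda>x. indicator {x. x \<bullet> i \<le> a} x) \<in> trig_closure"
proof (rule closure_bounded_limit)
  define f where "f n y = max 0 (min 1 (1 - real n * (y - a)))" for n and y :: real
  show "(\<lambda>x. complex_of_real (f n (x \<bullet> i))) \<in> trig_closure" for n
    by (rule closure_coordinate[where C = 1]) (auto simp: f_def intro!: continuous_intros)
  show "norm (complex_of_real (f n (x \<bullet> i))) \<le> 1" for n x by (auto simp: f_def)
  fix x
  show "(\<lambda>n. complex_of_real (f n (x \<bullet> i))) \<longlonglongrightarrow> indicator {x. x \<bullet> i \<le> a} x"
  proof (cases "x \<bullet> i \<le> a")
    case True
    then have "f n (x \<bullet> i) = 1" for n by (auto simp: f_def mult_nonneg_nonpos)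
    then show ?thesis using True by simp
  next
    case False
    then have "\<forall>\<^sub>F n in sequentially. real n * (x \<bullet> i - a) > 1"
      using filterlim_at_top_dense[of "\<lambda>n. real n * (x \<bullet> i - a)" sequentially]
        filterlim_at_top_mult_tendsto_pos[OF tendsto_const[of "x \<bullet> i - a"], of "\<lambda>n. real n" sequentially]
        filterlim_real_sequentially by simp
    then have "\<forall>\<^sub>F n in sequentially. complex_of_real (f n (x \<bullet> i)) = 0"
      by eventually_elim (simp add: f_def)
    then show ?thesis using False by (simp add: tendsto_eventually)
  qed
qed

lemma closure_indicator:
  assumes "A \<in> sets borel" shows "(\<lambda>x. indicator A x) \<in> trig_closure"
proof -
  have complement: "(\<lambda>x. indicator (UNIV - B) x) \<in> trig_closure" if "(\<lambda>x. indicator B x) \<in> trig_closure" for B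
  proof -
    have "(\<lambda>x. 1 * cis (0 \<bullet> x) + - 1 * indicator B x) \<in> trig_closure"
      by (intro closure_add closure_scale that closure_trig trig_cis)
    then show ?thesis
      by (rule back_subst[of "\<lambda>f. f \<in> trig_closure"]) (auto simp: fun_eq_iff indicator_def)
  qed
  have "A \<in> sigma_sets UNIV ((\<lambda>(a, i). {x::'a. x \<bullet> i \<le> a}) ` (UNIV \<times> Basis))"
    using assms by (simp add: borel_eq_halfspace_le)
  then show ?thesis
  proof (induction rule: sigma_sets.induct)
    case (Basic a)
    then show ?case using closure_halfspace by auto
  next
    case Empty
    show ?case using closure_trig[OF trig_cis[of 0 0]] by simp
  next
    case (Compl B)
    show ?case by (rule complement[OF Compl.IH])
  next
    case (Union B)
    have inter: "(\<lambda>x. indicator (\<Inter>k<n. UNIV - B k) x) \<in> trig_closure" for n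
    proof (induction n)
      case 0
      show ?case using closure_trig[OF trig_cis[of 1 0]] by simp
    next
      case (Suc n)
      have "(\<lambda>x. indicator (UNIV - B n) x * indicator (\<Inter>k<n. UNIV - B k) x) \<in> trig_closure"
        by (rule closure_mult[OF Suc complement[OF Union.IH], where C = 1]) (simp add: indicator_def)
      then show ?case
        by (rule back_subst[of "\<lambda>f. f \<in> trig_closure"])
          (auto simp: fun_eq_iff indicator_def lessThan_Suc)
    qed
    have *: "(\<lambda>x. indicator (\<Union>k<n. B k) x) \<in> trig_closure" for n
      by (rule back_subst[of "\<lambda>f. f \<in> trig_closure", OF complement[OF inter[of n]]]) (auto simp: fun_eq_iff indicator_def)
    show ?case
    proof (rule closure_bounded_limit[OF *])
      show "norm (indicator (\<Union>k<n. B k) x :: complex) \<le> 1" for n x by (simp add: indicator_def)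
      show "(\<lambda>n. indicator (\<Union>k<n. B k) x) \<longlonglongrightarrow> (indicator (\<Union>k. B k) x :: complex)" for x
        by (rule LIMSEQ_indicator_UN)
    qed
  qed
qed

theorem trig_dense:
  assumes q: "q \<in> L2 M" shows "q \<in> trig_closure"
proof -
  have q': "q \<in> borel_measurable M" using q by auto
  obtain s where s: "\<And>n. simple_function M (s n)" "\<And>x. x \<in> space M \<Longrightarrow> (\<lambda>n. s n x) \<longlonglongrightarrow> q x"
      "\<And>n x. x \<in> space M \<Longrightarrow> norm (s n x) \<le> 2 * norm (q x)"
    using borel_measurable_implies_sequence_metric[OF q', of 0] unfolding norm_conv_dist by blast
  have sp: "space M = UNIV" using sets_eq_imp_space_eq[OF sets_eq] by simp
  have cl: "s n \<in> trig_closure" for n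
  proof -
    have "(\<lambda>x. \<Sum>y\<in>F. y * indicator (s n -` {y}) x) \<in> trig_closure" if "finite F" for F
      using that
    proof induction
      case empty
      show ?case using closure_trig[OF trig_cis[of 0 0]] by simp
    next
      case (insert y F)
      have "s n -` {y} \<in> sets borel"
        using simple_functionD(2)[OF s(1)[of n], of "{y}"] by (simp add: sp sets_eq)
      from closure_add[OF closure_scale[OF closure_indicator[OF this], of y] insert.IH]
      show ?case unfolding sum.insert[OF insert.hyps(1,2)] .
    qed
    from this[of "range (s n)"]
    have "(\<lambda>x. \<Sum>y\<in>range (s n). y * indicator (s n -` {y}) x) \<in> trig_closure"
      using simple_functionD(1)[OF s(1)[of n]] by (simp add: sp)
    moreover have "s n = (\<lambda>x. \<Sum>y\<in>range (s n). y * indicator (s n -` {y}) x)"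
    proof
      fix x
      have "s n x = (\<Sum>y\<in>range (s n). indicator (s n -` {y} \<inter> UNIV) x *\<^sub>R y)"
        using simple_function_indicator_representation_banach[OF s(1)[of n], of x] unfolding sp by blast
      also have "\<dots> = (\<Sum>y\<in>range (s n). y * indicator (s n -` {y}) x)"
        by (rule sum.cong) (auto simp: indicator_def)
      finally show "s n x = (\<Sum>y\<in>range (s n). y * indicator (s n -` {y}) x)" .
    qed
    ultimately show ?thesis by (rule ssubst[rotated])
  qed
  show ?thesis
  proof (rule closure_limit[of q s, OF q cl], rule L2_dominated)
    show "integrable M (\<lambda>x. 9 * (norm (q x))\<^sup>2)" using L2_integrable_sq[OF q] by simp
    show "AE x in M. (norm (s n x - q x))\<^sup>2 \<le> 9 * (norm (q x))\<^sup>2" for n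
    proof (rule AE_I2)
      fix x assume "x \<in> space M"
      then have "norm (s n x - q x) \<le> 3 * norm (q x)"
        using s(3)[of x n] norm_triangle_ineq4[of "s n x" "q x"] by linarith
      then have "(norm (s n x - q x))\<^sup>2 \<le> (3 * norm (q x))\<^sup>2" by (rule power_mono) simp
      then show "(norm (s n x - q x))\<^sup>2 \<le> 9 * (norm (q x))\<^sup>2" by (simp add: power_mult_distrib)
    qed
    show "s n \<in> borel_measurable M" for n using closure_L2[OF cl] by auto
  qed (use q' s(2) in auto)
qed

end

section \<open>Gaussian integrals and linear isometries\<close>

lemma nn_integral_lborel_translate:
  fixes f :: "'a::euclidean_space \<Rightarrow> ennreal"
  assumes [measurable]: "f \<in> borel_measurable borel"
  shows "(\<integral>\<^sup>+x. f (x + a) \<partial>lborel) = (\<integral>\<^sup>+x. f x \<partial>lborel)"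
  by (subst (2) lborel_distr_plus[of a, symmetric], subst nn_integral_distr) (auto simp: add.commute)

lemma lborel_translate:
  fixes f :: "'a::euclidean_space \<Rightarrow> complex"
  assumes [measurable]: "f \<in> borel_measurable borel"
  shows "integrable lborel (\<lambda>x. f (x + a)) \<longleftrightarrow> integrable lborel f"
    "(LINT x|lborel. f (x + a)) = (LINT x|lborel. f x)"
proof -
  have "integrable (distr lborel borel ((+) a)) f \<longleftrightarrow> integrable lborel (\<lambda>x. f (a + x))"
    by (rule integrable_distr_eq) auto
  then show "integrable lborel (\<lambda>x. f (x + a)) \<longleftrightarrow> integrable lborel f"
    by (simp add: lborel_distr_plus add.commute)
  have "(LINT x|distr lborel borel ((+) a). f x) = (LINT x|lborel. f (a + x))"
    by (rule integral_distr) auto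
  then show "(LINT x|lborel. f (x + a)) = (LINT x|lborel. f x)"
    by (simp add: lborel_distr_plus add.commute)
qed

lemma nn_integral_gaussian_1:
  "(\<integral>\<^sup>+t. ennreal (exp (- t\<^sup>2 / 2)) \<partial>lborel) = ennreal (sqrt (2 * pi))"
proof -
  have "(\<integral>\<^sup>+t. ennreal (exp (- t\<^sup>2 / 2)) \<partial>lborel) = (\<integral>\<^sup>+t. ennreal (sqrt (2 * pi)) * ennreal (std_normal_density t) \<partial>lborel)"
    by (intro nn_integral_cong) (simp add: ennreal_mult[symmetric] std_normal_density_def)
  also have "\<dots> = ennreal (sqrt (2 * pi)) * (\<integral>\<^sup>+t. ennreal (std_normal_density t) \<partial>lborel)"
    by (rule nn_integral_cmult) auto
  also have "(\<integral>\<^sup>+t. ennreal (std_normal_density t) \<partial>lborel) = 1"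
    by (subst nn_integral_eq_integral) (auto simp: integral_std_normal_moment_even[of 0, simplified])
  finally show ?thesis by simp
qed

lemma nn_integral_gaussian:
  "(\<integral>\<^sup>+x. ennreal (exp (- (norm x)\<^sup>2 / 2)) \<partial>(lborel :: 'a::euclidean_space measure)) = ennreal (sqrt (2 * pi) ^ DIM('a))"
proof -
  have "exp (- (norm x)\<^sup>2 / 2) = (\<Prod>b\<in>Basis. exp (- (x \<bullet> b)\<^sup>2 / 2))" for x :: 'a
  proof -
    have "(norm x)\<^sup>2 = (\<Sum>b\<in>Basis. (x \<bullet> b)\<^sup>2)"
      by (subst power2_norm_eq_inner, subst euclidean_inner) (simp add: power2_eq_square)
    then show ?thesis by (simp add: exp_sum[symmetric] sum_negf sum_divide_distrib)
  qed
  then have "(\<integral>\<^sup>+x. ennreal (exp (- (norm x)\<^sup>2 / 2)) \<partial>(lborel :: 'a measure))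
      = (\<integral>\<^sup>+x. (\<Prod>b\<in>Basis. ennreal (exp (- (x \<bullet> b)\<^sup>2 / 2))) \<partial>(lborel :: 'a measure))"
    by (simp add: prod_ennreal)
  also have "\<dots> = (\<Prod>b\<in>(Basis :: 'a set). \<integral>\<^sup>+t. ennreal (exp (- t\<^sup>2 / 2)) \<partial>lborel)"
    by (rule nn_integral_lborel_prod[of "\<lambda>_ t. ennreal (exp (- t\<^sup>2 / 2))"]) auto
  also have "\<dots> = ennreal (sqrt (2 * pi) ^ DIM('a))"
    by (subst nn_integral_gaussian_1) (simp add: ennreal_power)
  finally show ?thesis .
qed

text \<open>The proof compares with one function that is invariant under isometries, the Gaussian \<open>g\<close>.
  Translation invariance and Tonelli's theorem turn the integral of \<open>f (T x) * g y\<close> over both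
  variables into that of \<open>f y * g (y - T x)\<close>; since \<open>g (y - T x) = g (x - T' y)\<close>, the integral
  over \<open>x\<close> is again the total mass of \<open>g\<close>, which is finite and positive and cancels.\<close>

lemma lborel_distr_isometry:
  fixes T T' :: "'a::euclidean_space \<Rightarrow> 'a"
  assumes T: "linear T" and inv: "\<And>x. T (T' x) = x" and iso: "\<And>x. norm (T x) = norm x"
  shows "distr lborel borel T = lborel"
proof -
  define g :: "'a \<Rightarrow> ennreal" where "g x = ennreal (exp (- (norm x)\<^sup>2 / 2))" for x
  have [measurable]: "g \<in> borel_measurable borel" unfolding g_def by measurable
  have [measurable]: "T \<in> borel_measurable borel"
    by (intro borel_measurable_continuous_onI linear_continuous_on linear_conv_bounded_linear[THEN iffD1] T)
  define c where "c = (\<integral>\<^sup>+x. g x \<partial>lborel)"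
  have c: "c = ennreal (sqrt (2 * pi) ^ DIM('a))" unfolding c_def g_def by (rule nn_integral_gaussian)
  have eq: "(\<integral>\<^sup>+x. f (T x) \<partial>lborel) = (\<integral>\<^sup>+x. f x \<partial>lborel)"
    if [measurable]: "f \<in> borel_measurable borel" for f :: "'a \<Rightarrow> ennreal"
  proof -
    have "(\<integral>\<^sup>+x. f (T x) \<partial>lborel) * c = (\<integral>\<^sup>+x. (\<integral>\<^sup>+y. f (T x) * g y \<partial>lborel) \<partial>lborel)"
      by (simp add: nn_integral_cmult nn_integral_multc c_def)
    also have "\<dots> = (\<integral>\<^sup>+y. (\<integral>\<^sup>+x. f (T x) * g y \<partial>lborel) \<partial>lborel)"
      by (rule lborel_pair.Fubini') measurable
    also have "\<dots> = (\<integral>\<^sup>+y. (\<integral>\<^sup>+x. f (T x + y) * g y \<partial>lborel) \<partial>lborel)"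
    proof (rule nn_integral_cong)
      fix y :: 'a
      have "(\<integral>\<^sup>+x. f (T x) * g y \<partial>lborel) = (\<integral>\<^sup>+x. f (T (x + T' y)) * g y \<partial>lborel)"
        by (rule nn_integral_lborel_translate[symmetric]) measurable
      then show "(\<integral>\<^sup>+x. f (T x) * g y \<partial>lborel) = (\<integral>\<^sup>+x. f (T x + y) * g y \<partial>lborel)"
        by (simp add: linear_add[OF T] inv)
    qed
    also have "\<dots> = (\<integral>\<^sup>+x. (\<integral>\<^sup>+y. f (T x + y) * g y \<partial>lborel) \<partial>lborel)"
      by (rule lborel_pair.Fubini'[symmetric]) measurable
    also have "\<dots> = (\<integral>\<^sup>+x. (\<integral>\<^sup>+y. f y * g (y - T x) \<partial>lborel) \<partial>lborel)"
    proof (rule nn_integral_cong)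
      fix x :: 'a
      have "(\<integral>\<^sup>+y. f y * g (y - T x) \<partial>lborel) = (\<integral>\<^sup>+y. f (y + T x) * g (y + T x - T x) \<partial>lborel)"
        by (rule nn_integral_lborel_translate[symmetric]) measurable
      then show "(\<integral>\<^sup>+y. f (T x + y) * g y \<partial>lborel) = (\<integral>\<^sup>+y. f y * g (y - T x) \<partial>lborel)"
        by (simp add: add.commute)
    qed
    also have "\<dots> = (\<integral>\<^sup>+y. (\<integral>\<^sup>+x. f y * g (y - T x) \<partial>lborel) \<partial>lborel)"
      by (rule lborel_pair.Fubini') measurable
    also have "\<dots> = (\<integral>\<^sup>+y. f y * c \<partial>lborel)"
    proof (rule nn_integral_cong)
      fix y :: 'a
      have "g (y - T x) = g (x + - T' y)" for x
      proof -
        have "norm (y - T x) = norm (T (T' y - x))" by (simp add: linear_diff[OF T] inv)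
        then show ?thesis by (simp add: g_def iso norm_minus_commute)
      qed
      then have "(\<integral>\<^sup>+x. g (y - T x) \<partial>lborel) = (\<integral>\<^sup>+x. g (x + - T' y) \<partial>lborel)" by simp
      also have "\<dots> = c" unfolding c_def by (rule nn_integral_lborel_translate) measurable
      finally show "(\<integral>\<^sup>+x. f y * g (y - T x) \<partial>lborel) = f y * c" by (simp add: nn_integral_cmult)
    qed
    also have "\<dots> = (\<integral>\<^sup>+x. f x \<partial>lborel) * c" by (simp add: nn_integral_multc)
    finally have "c * (\<integral>\<^sup>+x. f (T x) \<partial>lborel) = c * (\<integral>\<^sup>+x. f x \<partial>lborel)" by (simp only: mult.commute)
    then show ?thesis by (auto simp: c ennreal_mult_cancel_left)
  qed
  show ?thesis
  proof (rule measure_eqI)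
    fix A assume "A \<in> sets (distr lborel borel T)"
    then have [measurable]: "A \<in> sets borel" by simp
    have "emeasure (distr lborel borel T) A = (\<integral>\<^sup>+x. indicator A x \<partial>distr lborel borel T)" by simp
    also have "\<dots> = (\<integral>\<^sup>+x. indicator A (T x) \<partial>lborel)" by (rule nn_integral_distr) auto
    also have "\<dots> = (\<integral>\<^sup>+x. indicator A x \<partial>lborel)" by (rule eq) measurable
    finally show "emeasure (distr lborel borel T) A = emeasure lborel A" by simp
  qed simp
qed

text \<open>The substitution \<open>s = a/2 + x / sqrt 2\<close>, where \<open>\<zeta> = a + \<i> b\<close>, completes the square in the
  real part and leaves the characteristic function of the standard normal distribution at
  \<open>b / sqrt 2\<close>.\<close>

lemma gaussian_integral_1:
  fixes \<zeta> :: complex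
  shows "integrable lborel (\<lambda>s. exp (complex_of_real (- s\<^sup>2)) * exp (of_real s * \<zeta>))" (is "integrable _ ?f")
    and "(LINT s|lborel. exp (complex_of_real (- s\<^sup>2)) * exp (of_real s * \<zeta>)) = of_real (sqrt pi) * exp (\<zeta>\<^sup>2 / 4)"
proof -
  define a b where "a = Re \<zeta>" and "b = Im \<zeta>"
  have z: "\<zeta> = of_real a + \<i> * of_real b" by (simp add: a_def b_def complex_eq)
  define E where "E = of_real (sqrt (2 * pi)) * exp (of_real (a\<^sup>2 / 4) + \<i> * of_real (a * b / 2))"
  define g where "g x = complex_of_real (std_normal_density x) * iexp (b / sqrt 2 * x)" for x
  have subst: "?f (a / 2 + (1 / sqrt 2) * x) = E * g x" for x
  proof -
    have "- (complex_of_real (a / 2 + (1 / sqrt 2) * x))\<^sup>2 + of_real (a / 2 + (1 / sqrt 2) * x) * \<zeta>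
        = of_real (a\<^sup>2 / 4) + \<i> * of_real (a * b / 2) + of_real (- x\<^sup>2 / 2) + \<i> * of_real (b / sqrt 2 * x)"
      using real_sqrt_pow2[of 2] unfolding z
      by (simp add: complex_eq_iff power2_eq_square field_simps)
    then have "?f (a / 2 + (1 / sqrt 2) * x) = exp (of_real (a\<^sup>2 / 4) + \<i> * of_real (a * b / 2) + of_real (- x\<^sup>2 / 2) + \<i> * of_real (b / sqrt 2 * x))"
      unfolding exp_add[symmetric] by simp
    also have "\<dots> = E * g x"
    proof -
      have "sqrt (2 * pi) * std_normal_density x = exp (- x\<^sup>2 / 2)"
        by (simp add: std_normal_density_def)
      then have "complex_of_real (sqrt (2 * pi)) * complex_of_real (std_normal_density x) = exp (of_real (- x\<^sup>2 / 2))"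
        by (simp only: of_real_mult[symmetric] exp_of_real)
      from this[symmetric] show ?thesis by (simp only: E_def g_def exp_add mult_ac)
    qed
    finally show ?thesis .
  qed
  have g: "integrable lborel g" "(LINT x|lborel. g x) = exp (of_real (- b\<^sup>2 / 4))"
  proof -
    interpret real_distribution std_normal_distribution by (rule real_dist_normal_dist)
    have "integrable std_normal_distribution (\<lambda>x. iexp (b / sqrt 2 * x))"
      by (rule integrable_iexp) auto
    then have "integrable lborel (\<lambda>x. std_normal_density x *\<^sub>R iexp (b / sqrt 2 * x))"
      by (subst (asm) integrable_density) auto
    then show "integrable lborel g" by (simp add: g_def[abs_def] scaleR_conv_of_real)
    have "(LINT x|lborel. g x) = (LINT x|lborel. std_normal_density x *\<^sub>R iexp (b / sqrt 2 * x))"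
      by (simp add: g_def scaleR_conv_of_real)
    also have "\<dots> = char std_normal_distribution (b / sqrt 2)"
      unfolding char_def by (subst integral_density) auto
    also have "\<dots> = of_real (exp (- (b / sqrt 2)\<^sup>2 / 2))" by (simp only: char_std_normal_distribution)
    also have "- (b / sqrt 2)\<^sup>2 / 2 = - b\<^sup>2 / 4" by (simp add: power_divide)
    finally show "(LINT x|lborel. g x) = exp (of_real (- b\<^sup>2 / 4))" by (simp only: exp_of_real)
  qed
  show "integrable lborel ?f"
  proof -
    have "integrable lborel (\<lambda>x. ?f (a / 2 + (1 / sqrt 2) * x))"
      unfolding subst by (intro integrable_mult_right g)
    then show ?thesis by (subst (asm) lborel_integrable_real_affine_iff) simp_all
  qed
  have "(LINT s|lborel. ?f s) = (1 / sqrt 2) *\<^sub>R (LINT x|lborel. ?f (a / 2 + (1 / sqrt 2) * x))"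
    by (subst lborel_integral_real_affine[of "1 / sqrt 2" ?f "a / 2"]) auto
  also have "\<dots> = (1 / sqrt 2) *\<^sub>R (E * exp (of_real (- b\<^sup>2 / 4)))"
    unfolding subst by (simp add: g(2))
  also have "\<dots> = of_real (sqrt pi) * (exp (of_real (a\<^sup>2 / 4) + \<i> * of_real (a * b / 2)) * exp (of_real (- b\<^sup>2 / 4)))"
    by (simp add: E_def real_sqrt_mult scaleR_conv_of_real)
  also have "exp (of_real (a\<^sup>2 / 4) + \<i> * of_real (a * b / 2)) * exp (of_real (- b\<^sup>2 / 4)) = exp (\<zeta>\<^sup>2 / 4)"
    unfolding exp_add[symmetric] z
    by (rule arg_cong[where f = exp]) (simp add: complex_eq_iff power2_eq_square field_simps)
  finally show "(LINT s|lborel. ?f s) = of_real (sqrt pi) * exp (\<zeta>\<^sup>2 / 4)" .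
qed

lemma lborel_integral_prod_vec:
  fixes f :: "'n::finite \<Rightarrow> real \<Rightarrow> complex"
  assumes f: "\<And>j. integrable lborel (f j)"
  shows "integrable lborel (\<lambda>x :: real ^ 'n. \<Prod>j\<in>UNIV. f j (x $ j))"
    "(LINT x|(lborel :: (real ^ 'n) measure). (\<Prod>j\<in>UNIV. f j (x $ j))) = (\<Prod>j\<in>UNIV. (LINT t|lborel. f j t))"
proof -
  interpret product_sigma_finite "\<lambda>_ :: real ^ 'n. lborel :: real measure" ..
  have [measurable]: "f j \<in> borel_measurable borel" for j using f[of j] by auto
  define e :: "'n \<Rightarrow> real ^ 'n" where "e j = axis j 1" for j
  have inj: "inj e" by (auto simp: e_def inj_on_def axis_eq_axis)
  have B: "Basis = range e" by (auto simp: e_def Basis_vec_def)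
  define F where "F b = f (inv e b)" for b
  have Fe: "F (e j) = f j" for j using inj by (simp add: F_def)
  have prodB: "(\<Prod>b\<in>Basis. h b) = (\<Prod>j\<in>UNIV. h (e j))" for h :: "real ^ 'n \<Rightarrow> complex"
    unfolding B by (rule prod.reindex[OF inj, unfolded o_def])
  have comp: "(\<Sum>b\<in>Basis. y b *\<^sub>R b) $ j = y (e j)" for y :: "real ^ 'n \<Rightarrow> real" and j
  proof -
    have "(\<Sum>b\<in>Basis. y b *\<^sub>R b) $ j = (\<Sum>b\<in>Basis. y b *\<^sub>R b) \<bullet> e j" by (simp add: e_def cart_eq_inner_axis)
    also have "\<dots> = y (e j)" by (rule inner_sum_left_Basis) (simp add: B)
    finally show ?thesis .
  qed
  let ?P = "\<Pi>\<^sub>M b\<in>(Basis :: (real ^ 'n) set). (lborel :: real measure)"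
  let ?s = "\<lambda>y. \<Sum>b\<in>(Basis :: (real ^ 'n) set). y b *\<^sub>R b"
  have eq: "(\<Prod>j\<in>UNIV. f j (?s y $ j)) = (\<Prod>b\<in>Basis. F b (y b))" for y
    unfolding comp prodB Fe ..
  have intF: "integrable lborel (F b)" for b using f by (simp add: F_def)
  have "integrable ?P (\<lambda>y. \<Prod>b\<in>Basis. F b (y b))" by (rule product_integrable_prod) (auto intro: intF)
  then have "integrable (distr ?P borel ?s) (\<lambda>x. \<Prod>j\<in>UNIV. f j (x $ j))"
    by (subst integrable_distr_eq) (auto simp: eq simp del: sum_component)
  then show "integrable lborel (\<lambda>x :: real ^ 'n. \<Prod>j\<in>UNIV. f j (x $ j))"
    by (simp only: lborel_eq[symmetric])
  have "(LINT x|distr ?P borel ?s. (\<Prod>j\<in>UNIV. f j (x $ j))) = (LINT y|?P. (\<Prod>j\<in>UNIV. f j (?s y $ j)))"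
    by (rule integral_distr) measurable
  also have "\<dots> = (\<Prod>b\<in>Basis. (LINT t|lborel. F b t))"
    unfolding eq by (rule product_integral_prod) (auto intro: intF)
  also have "\<dots> = (\<Prod>j\<in>UNIV. (LINT t|lborel. f j t))" by (simp add: prodB Fe)
  finally show "(LINT x|(lborel :: (real ^ 'n) measure). (\<Prod>j\<in>UNIV. f j (x $ j))) = (\<Prod>j\<in>UNIV. (LINT t|lborel. f j t))"
    by (simp only: lborel_eq[symmetric])
qed

lemma norm_vec_sq: "(norm (u :: real ^ 'n))\<^sup>2 = (\<Sum>j\<in>UNIV. (u $ j)\<^sup>2)"
  by (subst power2_norm_eq_inner) (simp add: inner_vec_def power2_eq_square)

lemma gaussian_integral_vec:
  fixes \<zeta> :: "complex ^ 'n"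
  shows "integrable lborel (\<lambda>u. exp (complex_of_real (- (norm u)\<^sup>2)) * exp (cdot (of_real_vec u) \<zeta>))"
    and "(LINT u|lborel. exp (complex_of_real (- (norm u)\<^sup>2)) * exp (cdot (of_real_vec u) \<zeta>))
      = of_real (pi powr (real CARD('n) / 2)) * exp (cdot \<zeta> \<zeta> / 4)"
proof -
  have eq: "exp (complex_of_real (- (norm u)\<^sup>2)) * exp (cdot (of_real_vec u) \<zeta>)
      = (\<Prod>j\<in>UNIV. exp (complex_of_real (- (u $ j)\<^sup>2)) * exp (of_real (u $ j) * \<zeta> $ j))" for u :: "real ^ 'n"
    by (simp add: norm_vec_sq cdot_def of_real_vec_def exp_sum prod.distrib sum_negf[symmetric] del: sum_negf)
  show "integrable lborel (\<lambda>u. exp (complex_of_real (- (norm u)\<^sup>2)) * exp (cdot (of_real_vec u) \<zeta>))"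
    unfolding eq by (rule lborel_integral_prod_vec(1)) (rule gaussian_integral_1)
  have "(LINT u|lborel. exp (complex_of_real (- (norm u)\<^sup>2)) * exp (cdot (of_real_vec u) \<zeta>))
      = (\<Prod>j\<in>UNIV. of_real (sqrt pi) * exp ((\<zeta> $ j)\<^sup>2 / 4))"
    unfolding eq by (subst lborel_integral_prod_vec(2)) (auto intro: gaussian_integral_1(1) simp only: gaussian_integral_1(2))
  also have "\<dots> = of_real (sqrt pi ^ CARD('n)) * exp (cdot \<zeta> \<zeta> / 4)"
    by (simp add: prod.distrib exp_sum[symmetric] cdot_def sum_divide_distrib power2_eq_square)
  also have "sqrt pi ^ CARD('n) = pi powr (real CARD('n) / 2)"
    by (simp add: powr_half_sqrt[symmetric] powr_powr powr_realpow[symmetric])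
  finally show "(LINT u|lborel. exp (complex_of_real (- (norm u)\<^sup>2)) * exp (cdot (of_real_vec u) \<zeta>))
      = of_real (pi powr (real CARD('n) / 2)) * exp (cdot \<zeta> \<zeta> / 4)" .
qed

section \<open>Entire functions and the reproducing kernel of the Fock space\<close>

definition vec_cnj :: "complex ^ 'n \<Rightarrow> complex ^ 'n" where
  "vec_cnj z = (\<chi> j. cnj (z $ j))"

lemma cdot_commute: "cdot z w = cdot w z"
  by (simp add: cdot_def mult.commute)

lemma cdot_add: "cdot (x + y) z = cdot x z + cdot y z" "cdot z (x + y) = cdot z x + cdot z y"
  by (simp_all add: cdot_def distrib_left distrib_right sum.distrib)

lemma cdot_diff: "cdot (x - y) z = cdot x z - cdot y z" "cdot z (x - y) = cdot z x - cdot z y"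
  by (simp_all add: cdot_def left_diff_distrib right_diff_distrib sum_subtractf)

lemma cdot_scale: "cdot (c *s x) z = c * cdot x z" "cdot z (c *s x) = c * cdot z x"
  by (simp_all add: cdot_def sum_distrib_left mult_ac)

lemma cdot_zero [simp]: "cdot 0 z = 0" "cdot z 0 = 0"
  by (simp_all add: cdot_def)

lemma cnj_cdot: "cnj (cdot z w) = cdot (vec_cnj z) (vec_cnj w)"
  by (simp add: cdot_def vec_cnj_def)

lemma vec_cnj_diff: "vec_cnj (x - y) = vec_cnj x - vec_cnj y"
  by (simp add: vec_cnj_def vec_eq_iff)

lemma vec_cnj_add: "vec_cnj (x + y) = vec_cnj x + vec_cnj y"
  by (simp add: vec_cnj_def vec_eq_iff)

lemma vec_cnj_vec_cnj [simp]: "vec_cnj (vec_cnj x) = x"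
  by (simp add: vec_cnj_def vec_eq_iff)

lemma cdot_vec_cnj_self: "cdot z (vec_cnj z) = of_real ((norm z)\<^sup>2)"
proof -
  have "(norm z)\<^sup>2 = (\<Sum>j\<in>UNIV. (norm (z $ j))\<^sup>2)"
    by (simp add: norm_vec_def L2_set_def sum_nonneg)
  then show ?thesis by (simp add: cdot_def vec_cnj_def complex_norm_square del: of_real_power)
qed

lemma linear_cdot_left: "linear (\<lambda>z. cdot z a)"
  by (rule linearI) (simp_all only: cdot_add, simp add: cdot_def scaleR_sum_right)

lemma cdot_continuous [continuous_intros]:
  assumes "continuous_on S f" "continuous_on S g"
  shows "continuous_on S (\<lambda>x. cdot (f x) (g x))"
  unfolding cdot_def by (intro continuous_intros assms)

lemma cdot_measurable [measurable]:
  assumes [measurable]: "f \<in> borel_measurable M" "g \<in> borel_measurable M"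
  shows "(\<lambda>x. cdot (f x) (g x)) \<in> borel_measurable M"
proof -
  have "(\<lambda>p. cdot (fst p) (snd p)) \<in> borel_measurable (borel :: ((complex ^ 'n) \<times> (complex ^ 'n)) measure)"
    by (intro borel_measurable_continuous_onI continuous_intros)
  from measurable_compose[OF _ this, of "\<lambda>x. (f x, g x)" M]
  show ?thesis by (simp add: borel_prod[symmetric])
qed

lemma of_real_vec_measurable [measurable]: "of_real_vec \<in> borel_measurable borel"
  unfolding of_real_vec_def by (intro borel_measurable_continuous_onI continuous_intros)

lemma vec_scale_measurable [measurable]: "(*s) c \<in> borel_measurable (borel :: (complex ^ 'n) measure)"
  unfolding vector_scalar_mult_def by (intro borel_measurable_continuous_onI continuous_intros)

lemma norm_vec_scale: "norm (c *s (z :: complex ^ 'n)) = norm c * norm z"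
  by (simp add: norm_vec_def norm_mult L2_set_right_distrib)

lemma linear_vec_scale: "linear ((*s) c :: complex ^ 'n \<Rightarrow> complex ^ 'n)"
  by (rule linearI) (simp_all add: vec_eq_iff distrib_left)

lemma entire_continuous: "entire F \<Longrightarrow> continuous_on UNIV F"
  unfolding entire_def continuous_on_eq_continuous_at[OF open_UNIV]
  using has_derivative_continuous by blast

lemma entire_measurable: "entire F \<Longrightarrow> F \<in> borel_measurable borel"
  by (intro borel_measurable_continuous_onI entire_continuous)

lemma entire_mult:
  assumes "entire F" "entire G" shows "entire (\<lambda>z. F z * G z)"
  unfolding entire_def
proof
  fix z
  obtain D E where D: "(F has_derivative D) (at z)" "\<forall>c v. D (c *s v) = c * D v"
    and E: "(G has_derivative E) (at z)" "\<forall>c v. E (c *s v) = c * E v"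
    using assms unfolding entire_def by blast
  have "((\<lambda>z. F z * G z) has_derivative (\<lambda>h. F z * E h + D h * G z)) (at z)"
    by (rule has_derivative_mult[OF D(1) E(1)])
  then show "\<exists>D. ((\<lambda>z. F z * G z) has_derivative D) (at z) \<and> (\<forall>c v. D (c *s v) = c * D v)"
    by (intro exI conjI) (auto simp: D(2) E(2) algebra_simps)
qed

lemma entire_add:
  assumes "entire F" "entire G" shows "entire (\<lambda>z. F z + G z)"
  unfolding entire_def
proof
  fix z
  obtain D E where D: "(F has_derivative D) (at z)" "\<forall>c v. D (c *s v) = c * D v"
    and E: "(G has_derivative E) (at z)" "\<forall>c v. E (c *s v) = c * E v"
    using assms unfolding entire_def by blast
  have "((\<lambda>z. F z + G z) has_derivative (\<lambda>h. D h + E h)) (at z)"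
    by (rule has_derivative_add[OF D(1) E(1)])
  then show "\<exists>D. ((\<lambda>z. F z + G z) has_derivative D) (at z) \<and> (\<forall>c v. D (c *s v) = c * D v)"
    by (intro exI conjI) (auto simp: D(2) E(2) algebra_simps)
qed

lemma entire_const: "entire (\<lambda>z. c)"
  unfolding entire_def by (intro allI exI[of _ "\<lambda>_. 0"]) auto

lemma entire_translate:
  assumes "entire F" shows "entire (\<lambda>z. F (z + a))"
  unfolding entire_def
proof
  fix z
  obtain D where D: "(F has_derivative D) (at (z + a))" "\<forall>c v. D (c *s v) = c * D v"
    using assms unfolding entire_def by blast
  have "((\<lambda>z. z + a) has_derivative (\<lambda>h. h)) (at z)" by (auto intro!: derivative_eq_intros)
  from has_derivative_compose[OF this, of F D] D(1)
  have "((\<lambda>z. F (z + a)) has_derivative D) (at z)" by simp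
  with D(2) show "\<exists>D. ((\<lambda>z. F (z + a)) has_derivative D) (at z) \<and> (\<forall>c v. D (c *s v) = c * D v)" by blast
qed

lemma entire_exp_cdot: "entire (\<lambda>z. exp (cdot z a))"
  unfolding entire_def
proof
  fix z
  have "((\<lambda>z. cdot z a) has_derivative (\<lambda>h. cdot h a)) (at z)"
    by (rule linear_imp_has_derivative[OF linear_cdot_left])
  then have "((\<lambda>z. exp (cdot z a)) has_derivative (\<lambda>h. exp (cdot z a) * cdot h a)) (at z)"
    by (rule has_derivative_compose[OF _ DERIV_exp[unfolded has_field_derivative_def]])
  then show "\<exists>D. ((\<lambda>z. exp (cdot z a)) has_derivative D) (at z) \<and> (\<forall>c v. D (c *s v) = c * D v)"
    by (intro exI conjI) (auto simp: cdot_scale algebra_simps)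
qed

lemma has_integral_cancel_factor:
  fixes k :: complex
  assumes "((\<lambda>t. k * f t) has_integral k * c) S" "k \<noteq> 0"
  shows "(f has_integral c) S"
  using has_integral_mult_right[OF assms(1), of "inverse k"] assms(2) by (simp add: mult.assoc[symmetric])

text \<open>Cauchy's integral formula on the unit circle of the complex line through \<open>0\<close> and \<open>z\<close>.\<close>

lemma entire_circle_average:
  assumes F: "entire F"
  defines "e \<equiv> \<lambda>t::real. exp (2 * of_real pi * \<i> * of_real t)"
  shows "(LINT t:{0..1}|lborel. F (e t *s z)) = F 0"
proof -
  define h where "h c = F (c *s z)" for c
  have "h field_differentiable at c" for c
  proof -
    obtain D where D: "(F has_derivative D) (at (c *s z))" "\<forall>c v. D (c *s v) = c * D v"
      using F unfolding entire_def by blast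
    have "linear (\<lambda>c. c *s z)" by (rule linearI) (simp_all add: vec_eq_iff distrib_right)
    then have "((\<lambda>c. c *s z) has_derivative (\<lambda>c. c *s z)) (at c)" by (rule linear_imp_has_derivative)
    from has_derivative_compose[OF this D(1)]
    have "(h has_derivative (\<lambda>d. D z * d)) (at c)" by (simp add: h_def[abs_def] D(2) mult.commute)
    then show ?thesis by (auto simp: field_differentiable_def has_field_derivative_def)
  qed
  then have h: "h holomorphic_on S" for S by (simp add: holomorphic_on_def field_differentiable_at_within)
  have "((\<lambda>u. h u / (u - 0)) has_contour_integral (2 * of_real pi * \<i> * h 0)) (circlepath 0 1)"
    by (rule Cauchy_integral_circlepath_simple[OF h]) simp
  then have "((\<lambda>t. (2 * of_real pi * \<i>) * h (e t)) has_integral (2 * of_real pi * \<i> * h 0)) {0..1}"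
    unfolding has_contour_integral_def
  proof (rule has_integral_eq[rotated])
    fix t :: real assume t: "t \<in> {0..1}"
    have c: "circlepath 0 1 t = e t" by (simp add: circlepath e_def)
    have "vector_derivative (circlepath 0 1) (at t within {0..1}) = 2 * of_real pi * \<i> * e t"
      using t by (simp add: vector_derivative_circlepath01 e_def)
    moreover have "e t \<noteq> 0" by (simp add: e_def)
    ultimately show "h (circlepath 0 1 t) / (circlepath 0 1 t - 0) * vector_derivative (circlepath 0 1) (at t within {0..1})
        = 2 * of_real pi * \<i> * h (e t)" by (simp add: c)
  qed
  moreover have "2 * of_real pi * \<i> \<noteq> 0" by simp
  ultimately have I: "((\<lambda>t. h (e t)) has_integral h 0) {0..1}"
    by (rule has_integral_cancel_factor)
  have "continuous_on {0..1} (\<lambda>t. h (e t))"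
    unfolding e_def
    by (intro continuous_on_compose2[OF holomorphic_on_imp_continuous_on[OF h[of UNIV]]] continuous_intros) auto
  then have "set_integrable lborel {0..1} (\<lambda>t. h (e t))" by (rule borel_integrable_atLeastAtMost')
  from set_borel_integral_eq_integral(2)[OF this] I show ?thesis
    by (simp add: integral_unique h_def)
qed

lemma sets_fock_measure [simp, measurable_cong]: "sets fock_measure = sets borel"
  by (simp add: fock_measure_def)

lemma space_fock_measure [simp]: "space fock_measure = UNIV"
  by (simp add: fock_measure_def)

definition fock_density :: "complex ^ 'n \<Rightarrow> real" where
  "fock_density z = 1 / (2 * pi) ^ CARD('n) * exp (- (norm z)\<^sup>2 / 2)"

lemma fock_density_nonneg: "0 \<le> fock_density z" by (simp add: fock_density_def)

lemma fock_density_measurable [measurable]: "fock_density \<in> borel_measurable borel"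
  unfolding fock_density_def by measurable

lemma fock_measure_eq: "fock_measure = density lborel (\<lambda>z. ennreal (fock_density z))"
  by (simp add: fock_measure_def fock_density_def)

lemma integral_fock:
  fixes f :: "complex ^ 'n \<Rightarrow> complex"
  assumes "f \<in> borel_measurable borel"
  shows "integrable fock_measure f \<longleftrightarrow> integrable lborel (\<lambda>z. of_real (fock_density z) * f z)"
    "(LINT z|fock_measure. f z) = (LINT z|lborel. of_real (fock_density z) * f z)"
  unfolding fock_measure_eq using assms
  by (subst integrable_density integral_density, auto simp: fock_density_nonneg scaleR_conv_of_real)+

lemma emeasure_fock_measure: "emeasure (fock_measure :: (complex ^ 'n) measure) UNIV = 1"
proof -
  have "emeasure (fock_measure :: (complex ^ 'n) measure) UNIV = (\<integral>\<^sup>+z. ennreal (fock_density (z :: complex ^ 'n)) \<partial>lborel)"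
    unfolding fock_measure_eq by (subst emeasure_density) auto
  also have "\<dots> = (\<integral>\<^sup>+z. ennreal (1 / (2 * pi) ^ CARD('n)) * ennreal (exp (- (norm (z :: complex ^ 'n))\<^sup>2 / 2)) \<partial>lborel)"
    unfolding fock_density_def by (intro nn_integral_cong ennreal_mult) auto
  also have "\<dots> = ennreal (1 / (2 * pi) ^ CARD('n)) * ennreal (sqrt (2 * pi) ^ DIM(complex ^ 'n))"
    by (subst nn_integral_cmult, measurable, subst nn_integral_gaussian, rule refl)
  also have "sqrt (2 * pi) ^ DIM(complex ^ 'n) = (2 * pi) ^ CARD('n)"
    by (simp add: mult.commute[of _ 2] power_mult)
  also have "ennreal (1 / (2 * pi) ^ CARD('n)) * ennreal ((2 * pi) ^ CARD('n)) = 1"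
    by (simp add: ennreal_mult[symmetric])
  finally show ?thesis .
qed

interpretation fock_prob: prob_space "fock_measure :: (complex ^ 'n) measure"
  by (rule prob_spaceI) (simp add: emeasure_fock_measure)

lemma fock_measure_rotate:
  assumes c: "norm c = 1"
  shows "distr fock_measure borel ((*s) c) = (fock_measure :: (complex ^ 'n) measure)"
proof (rule measure_eqI)
  fix A :: "(complex ^ 'n) set" assume "A \<in> sets (distr fock_measure borel ((*s) c))"
  then have A[measurable]: "A \<in> sets borel" by simp
  have c': "c * inverse c = 1" using c by (intro right_inverse) auto
  have lb: "distr lborel borel ((*s) c) = (lborel :: (complex ^ 'n) measure)"
    by (rule lborel_distr_isometry[where T' = "(*s) (inverse c)"])
      (simp_all add: linear_vec_scale norm_vec_scale c vec_eq_iff mult.assoc[symmetric] c')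
  have "emeasure (distr fock_measure borel ((*s) c)) A = emeasure fock_measure ((*s) c -` A)"
    by (simp add: emeasure_distr)
  also have "\<dots> = (\<integral>\<^sup>+z. ennreal (fock_density z) * indicator ((*s) c -` A) z \<partial>lborel)"
    unfolding fock_measure_eq using measurable_sets_borel[OF vec_scale_measurable A] by (simp add: emeasure_density)
  also have "\<dots> = (\<integral>\<^sup>+z. ennreal (fock_density (c *s z)) * indicator A (c *s z) \<partial>lborel)"
    by (intro nn_integral_cong) (auto simp: fock_density_def norm_vec_scale c indicator_def)
  also have "\<dots> = (\<integral>\<^sup>+z. ennreal (fock_density z) * indicator A z \<partial>distr lborel borel ((*s) c))"
    by (rule nn_integral_distr[symmetric]) auto
  also have "\<dots> = emeasure fock_measure A"
    unfolding lb fock_measure_eq by (simp add: emeasure_density)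
  finally show "emeasure (distr fock_measure borel ((*s) c)) A = emeasure fock_measure A" .
qed simp

text \<open>By rotation invariance \<open>G\<close> may be replaced by its average over the rotated functions
  \<open>z \<mapsto> G (e t *s z)\<close>, which is the constant \<open>G 0\<close>.  This treats all coordinates at once, with
  one circle instead of a polydisc.\<close>

lemma fock_mean_value:
  fixes G :: "complex ^ 'n \<Rightarrow> complex"
  assumes G: "entire G" and int: "integrable fock_measure G"
  shows "(LINT z|fock_measure. G z) = G 0"
proof -
  define e where "e t = exp (2 * of_real pi * \<i> * of_real t)" for t :: real
  have ne: "norm (e t) = 1" for t by (simp add: e_def)
  have [measurable]: "e \<in> borel_measurable borel"
    unfolding e_def by measurable
  have [measurable]: "G \<in> borel_measurable borel" using G by (rule entire_measurable)
  define N where "N = density lborel (\<lambda>t::real. ennreal (indicator {0..1} t))"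
  have setsN[measurable_cong]: "sets N = sets borel" by (simp add: N_def)
  interpret N: prob_space N
    by (rule prob_spaceI) (simp add: N_def emeasure_density ennreal_indicator)
  interpret pair: pair_sigma_finite N "fock_measure :: (complex ^ 'n) measure" ..
  have N_int: "(LINT t|N. f t) = (LINT t:{0..1}|lborel. f t)" if "f \<in> borel_measurable borel" for f :: "real \<Rightarrow> complex"
    unfolding N_def set_lebesgue_integral_def using that by (subst integral_density) auto
  have m[measurable]: "(\<lambda>p. G (e (fst p) *s snd p)) \<in> borel_measurable (borel \<Otimes>\<^sub>M borel)"
  proof -
    have "continuous_on UNIV (\<lambda>p :: real \<times> (complex ^ 'n). e (fst p) *s snd p)"
      unfolding e_def vector_scalar_mult_def by (intro continuous_intros)
    then have "continuous_on UNIV (\<lambda>p :: real \<times> (complex ^ 'n). G (e (fst p) *s snd p))"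
      by (rule continuous_on_compose2[OF entire_continuous[OF G]]) auto
    then show ?thesis unfolding borel_prod by (rule borel_measurable_continuous_onI)
  qed
  have rot: "integrable fock_measure (\<lambda>z. G (e t *s z))" "(LINT z|fock_measure. G (e t *s z)) = (LINT z|fock_measure. G z)"
    "(LINT z|fock_measure. norm (G (e t *s z))) = (LINT z|fock_measure. norm (G z))" for t
  proof -
    note r = fock_measure_rotate[OF ne[of t], where 'n = 'n]
    have "integrable (distr fock_measure borel ((*s) (e t))) G" using int by (simp add: r)
    then show "integrable fock_measure (\<lambda>z. G (e t *s z))" by (subst (asm) integrable_distr_eq) auto
    have "(LINT z|distr fock_measure borel ((*s) (e t)). G z) = (LINT z|fock_measure. G (e t *s z))"
      by (rule integral_distr) auto
    then show "(LINT z|fock_measure. G (e t *s z)) = (LINT z|fock_measure. G z)" by (simp add: r)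
    have "(LINT z|distr fock_measure borel ((*s) (e t)). norm (G z)) = (LINT z|fock_measure. norm (G (e t *s z)))"
      by (rule integral_distr) auto
    then show "(LINT z|fock_measure. norm (G (e t *s z))) = (LINT z|fock_measure. norm (G z))" by (simp add: r)
  qed
  have "integrable (N \<Otimes>\<^sub>M fock_measure) (\<lambda>p. G (e (fst p) *s snd p))"
  proof (rule pair.Fubini_integrable)
    show "(\<lambda>p. G (e (fst p) *s snd p)) \<in> borel_measurable (N \<Otimes>\<^sub>M fock_measure)" by measurable
    show "integrable N (\<lambda>t. LINT z|fock_measure. norm (G (e (fst (t, z)) *s snd (t, z))))" by (simp add: rot)
    show "AE t in N. integrable fock_measure (\<lambda>z. G (e (fst (t, z)) *s snd (t, z)))" by (simp add: rot)
  qed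
  then have p: "integrable (N \<Otimes>\<^sub>M fock_measure) (\<lambda>(t, z). G (e t *s z))" by (simp add: split_beta')
  have "(LINT z|fock_measure. G z) = (LINT t|N. (LINT z|fock_measure. G (e t *s z)))" by (simp add: rot N.prob_space)
  also have "\<dots> = (LINT z|fock_measure. (LINT t|N. G (e t *s z)))"
    by (rule pair.Fubini_integral[OF p, symmetric])
  also have "\<dots> = (LINT z|(fock_measure :: (complex ^ 'n) measure). G 0)"
  proof (rule Bochner_Integration.integral_cong[OF refl])
    fix z
    have "(LINT t|N. G (e t *s z)) = (LINT t:{0..1}|lborel. G (e t *s z))"
    proof (rule N_int)
      have "(\<lambda>t. (t, z)) \<in> borel \<rightarrow>\<^sub>M borel \<Otimes>\<^sub>M borel" by measurable
      from measurable_compose[OF this m] show "(\<lambda>t. G (e t *s z)) \<in> borel_measurable borel" by simp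
    qed
    then show "(LINT t|N. G (e t *s z)) = G 0"
      unfolding e_def by (simp only: entire_circle_average[OF G])
  qed
  also have "\<dots> = G 0" by (simp add: fock_prob.prob_space[simplified])
  finally show ?thesis .
qed

definition fock_kernel :: "complex ^ 'n \<Rightarrow> complex ^ 'n \<Rightarrow> complex" where
  "fock_kernel w z = exp (cdot z (vec_cnj w) / 2)"

lemma fock_kernel_cdot: "fock_kernel w z = exp (cdot z ((1/2) *s vec_cnj w))"
  by (simp add: fock_kernel_def cdot_scale)

lemma entire_fock_kernel: "entire (fock_kernel w)"
  unfolding fock_kernel_cdot[abs_def] by (rule entire_exp_cdot)

lemma fock_kernel_L2: "fock_kernel (w :: complex ^ 'n) \<in> L2 fock_measure"
proof -
  have [measurable]: "fock_kernel w \<in> borel_measurable borel" by (rule entire_measurable[OF entire_fock_kernel])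
  have eq: "fock_density z * (norm (fock_kernel w z))\<^sup>2 = exp ((norm w)\<^sup>2 / 2) * fock_density (z + (- w))" for z :: "complex ^ 'n"
  proof -
    have "complex_of_real ((norm (z + - w))\<^sup>2) = cdot (z - w) (vec_cnj (z - w))" by (simp add: cdot_vec_cnj_self)
    also have "\<dots> = of_real ((norm z)\<^sup>2) + of_real ((norm w)\<^sup>2) - (cdot z (vec_cnj w) + cnj (cdot z (vec_cnj w)))"
      by (simp add: vec_cnj_diff cdot_diff cdot_vec_cnj_self cnj_cdot cdot_commute[of w "vec_cnj z"] del: of_real_power)
    also have "cdot z (vec_cnj w) + cnj (cdot z (vec_cnj w)) = of_real (2 * Re (cdot z (vec_cnj w)))"
      by (rule complex_add_cnj)
    finally have n: "(norm (z + - w))\<^sup>2 = (norm z)\<^sup>2 + (norm w)\<^sup>2 - 2 * Re (cdot z (vec_cnj w))"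
      by (metis of_real_add of_real_diff of_real_eq_iff)
    have "(norm (fock_kernel w z))\<^sup>2 = exp (Re (cdot z (vec_cnj w)))"
      by (simp add: fock_kernel_def power2_eq_square exp_add[symmetric])
    moreover have "- (norm z)\<^sup>2 / 2 + Re (cdot z (vec_cnj w)) = (norm w)\<^sup>2 / 2 + - (norm (z + - w))\<^sup>2 / 2"
      unfolding n by (simp add: field_simps)
    then have "exp (- (norm z)\<^sup>2 / 2) * exp (Re (cdot z (vec_cnj w))) = exp ((norm w)\<^sup>2 / 2) * exp (- (norm (z + - w))\<^sup>2 / 2)"
      by (simp only: exp_add[symmetric])
    ultimately show ?thesis by (simp add: fock_density_def)
  qed
  have "(\<integral>\<^sup>+z. ennreal ((norm (fock_kernel w z))\<^sup>2) \<partial>fock_measure)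
      = (\<integral>\<^sup>+z. ennreal (fock_density z * (norm (fock_kernel w z))\<^sup>2) \<partial>lborel)"
    unfolding fock_measure_eq by (subst nn_integral_density) (auto simp: ennreal_mult fock_density_nonneg)
  also have "\<dots> = ennreal (exp ((norm w)\<^sup>2 / 2)) * (\<integral>\<^sup>+z. ennreal (fock_density (z + (- w))) \<partial>lborel)"
    unfolding eq by (subst nn_integral_cmult[symmetric]) (auto simp: ennreal_mult fock_density_nonneg)
  also have "(\<integral>\<^sup>+z. ennreal (fock_density (z + (- w))) \<partial>lborel) = (\<integral>\<^sup>+z. ennreal (fock_density (z :: complex ^ 'n)) \<partial>lborel)"
    by (rule nn_integral_lborel_translate[of "\<lambda>z. ennreal (fock_density z)" "- w"]) measurable
  also have "\<dots> = emeasure (fock_measure :: (complex ^ 'n) measure) UNIV"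
    unfolding fock_measure_eq by (subst emeasure_density) auto
  finally have "(\<integral>\<^sup>+z. ennreal ((norm (fock_kernel w z))\<^sup>2) \<partial>fock_measure) < \<infinity>"
    by (simp add: emeasure_fock_measure)
  then show ?thesis by (auto simp: L2_def integrable_iff_bounded)
qed

lemma fock_kernel_fock: "fock_kernel w \<in> fock"
  by (simp add: fock_def fock_kernel_L2 entire_fock_kernel)

text \<open>The mean value property is applied to \<open>F\<close> translated by \<open>w\<close> and multiplied by the entire factor
  that restores the Gaussian weight: after translating back by \<open>w\<close>, the density and this factor
  combine to the original density times the conjugate of the kernel.\<close>

theorem fock_reproducing:
  assumes F: "F \<in> fock"
  shows "L2_inner fock_measure F (fock_kernel w) = F w"
proof -
  have eF: "entire F" and LF: "F \<in> L2 fock_measure" using F by (auto simp: fock_def)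
  note [measurable] = entire_measurable[OF eF] entire_measurable[OF entire_fock_kernel]
  define G where "G z = F (z + w) * exp (cdot z ((- 1/2) *s vec_cnj w))" for z
  have G: "entire G" unfolding G_def by (intro entire_mult entire_translate eF entire_exp_cdot)
  note [measurable] = entire_measurable[OF G]
  define H where "H z = of_real (fock_density z) * (F z * cnj (fock_kernel w z))" for z
  have [measurable]: "H \<in> borel_measurable borel" unfolding H_def by measurable
  have shift: "of_real (fock_density z) * G z = H (z + w)" for z
  proof -
    have "cnj (cdot (z + w) (vec_cnj w)) = cdot w (vec_cnj z) + cdot w (vec_cnj w)"
      by (simp add: cnj_cdot cdot_add vec_cnj_add cdot_commute)
    moreover have "complex_of_real ((norm (z + w))\<^sup>2) = cdot (z + w) (vec_cnj (z + w))"
      by (simp only: cdot_vec_cnj_self)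
    moreover have "cdot z ((- 1/2) *s vec_cnj w) = - cdot z (vec_cnj w) / 2"
      by (simp only: cdot_scale) simp
    ultimately have "- complex_of_real ((norm z)\<^sup>2) / 2 + cdot z ((- 1/2) *s vec_cnj w)
        = - complex_of_real ((norm (z + w))\<^sup>2) / 2 + cnj (cdot (z + w) (vec_cnj w) / 2)"
      by (simp only: complex_cnj_divide complex_cnj_numeral cdot_vec_cnj_self[of z, symmetric] cdot_add vec_cnj_add)
        (simp add: field_simps)
    then have "exp (- complex_of_real ((norm z)\<^sup>2) / 2) * exp (cdot z ((- 1/2) *s vec_cnj w))
        = exp (- complex_of_real ((norm (z + w))\<^sup>2) / 2) * cnj (fock_kernel w (z + w))"
      by (simp only: exp_add[symmetric] fock_kernel_def exp_cnj)
    moreover have "complex_of_real (fock_density x) = of_real (1 / (2 * pi) ^ CARD('a)) * exp (- complex_of_real ((norm x)\<^sup>2) / 2)" for x :: "complex ^ 'a"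
      by (simp add: fock_density_def flip: exp_of_real)
    ultimately show ?thesis by (simp add: G_def H_def mult_ac)
  qed
  have iH: "integrable lborel H"
    using L2_inner_integrable[OF LF fock_kernel_L2[of w]] unfolding H_def by (subst (asm) integral_fock) auto
  then have "integrable fock_measure G"
    by (simp add: integral_fock shift lborel_translate)
  then have "F w = (LINT z|fock_measure. G z)" using fock_mean_value[OF G] by (simp add: G_def)
  also have "\<dots> = (LINT z|lborel. H z)" by (simp add: integral_fock shift lborel_translate)
  also have "\<dots> = L2_inner fock_measure F (fock_kernel w)"
    unfolding L2_inner_def H_def by (rule integral_fock(2)[symmetric]) measurable
  finally show ?thesis ..
qed

section \<open>The Bargmann transform is isometric\<close>

definition bargmann_kernel :: "complex ^ 'n \<Rightarrow> real ^ 'n \<Rightarrow> complex" where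
  "bargmann_kernel z u = complex_of_real (pi powr (- real CARD('n) / 4)) * exp (- cdot z z / 4)
    * exp (complex_of_real (- (norm u)\<^sup>2 / 2)) * exp (cdot (of_real_vec u) z)"

text \<open>The conjugate of the integral kernel, so that the transform is the inner product with
  \<open>coherent z\<close>; these Gaussians are the preimages of the reproducing kernels.\<close>

definition coherent :: "complex ^ 'n \<Rightarrow> real ^ 'n \<Rightarrow> complex" where
  "coherent w u = cnj (bargmann_kernel w u)"

lemma L2_lborel_measurable: "f \<in> L2 lborel \<Longrightarrow> f \<in> borel_measurable borel"
  using L2_measurable[of f lborel] by simp

lemma bargmann_kernel_measurable [measurable]:
  assumes [measurable]: "f \<in> borel_measurable M" "g \<in> borel_measurable M"
  shows "(\<lambda>x. bargmann_kernel (f x) (g x)) \<in> borel_measurable M"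
  unfolding bargmann_kernel_def by measurable

lemma coherent_measurable [measurable]: "coherent w \<in> borel_measurable borel"
  unfolding coherent_def by measurable

lemma bargmann_eq: "bargmann f z = (LINT u|lborel. f u * bargmann_kernel z u)"
proof -
  have "(LINT u|lborel. f u * bargmann_kernel z u)
      = (LINT u|lborel. (complex_of_real (pi powr (- real CARD('a) / 4)) * exp (- cdot z z / 4))
        * (f u * exp (complex_of_real (- (norm u)\<^sup>2 / 2)) * exp (cdot (of_real_vec u) z)))"
    by (simp add: bargmann_kernel_def mult_ac)
  then show ?thesis by (simp add: bargmann_def mult.assoc)
qed

lemma bargmann_inner: "bargmann f z = L2_inner lborel f (coherent z)"
  by (simp add: bargmann_eq L2_inner_def coherent_def)

lemma coherent_prod:
  fixes w v :: "complex ^ 'n"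
  shows "coherent w u * cnj (coherent v u) = (of_real (pi powr (- real CARD('n) / 2)) * exp (- (cdot v v + cnj (cdot w w)) / 4))
    * (exp (complex_of_real (- (norm u)\<^sup>2)) * exp (cdot (of_real_vec u) (v + vec_cnj w)))"
proof -
  have "vec_cnj (of_real_vec u) = of_real_vec u" by (simp add: vec_cnj_def of_real_vec_def vec_eq_iff)
  then have "cnj (cdot (of_real_vec u) w) = cdot (of_real_vec u) (vec_cnj w)" by (simp add: cnj_cdot)
  moreover have "pi powr (- real CARD('n) / 2) = pi powr (- real CARD('n) / 4) * pi powr (- real CARD('n) / 4)"
    by (simp add: powr_add[symmetric])
  moreover have "exp (complex_of_real (- (norm u)\<^sup>2)) = exp (complex_of_real (- (norm u)\<^sup>2 / 2)) * exp (complex_of_real (- (norm u)\<^sup>2 / 2))"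
    by (simp add: exp_add[symmetric])
  moreover have "exp (- (cdot v v + cnj (cdot w w)) / 4) = exp (- cdot v v / 4) * exp (- cnj (cdot w w) / 4)"
    by (simp add: exp_add[symmetric] add_divide_distrib diff_divide_distrib)
  ultimately show ?thesis
    by (simp add: coherent_def bargmann_kernel_def exp_cnj cdot_add exp_add mult_ac)
qed

lemma coherent_L2: "coherent w \<in> L2 lborel"
proof -
  have "integrable lborel (\<lambda>u. coherent w u * cnj (coherent w u))"
    unfolding coherent_prod by (intro integrable_mult_right gaussian_integral_vec)
  then have "integrable lborel (\<lambda>u. norm (coherent w u * cnj (coherent w u)))" by (rule integrable_norm)
  then show ?thesis by (simp add: L2_def norm_mult power2_eq_square)
qed

lemma coherent_inner: "L2_inner lborel (coherent w) (coherent v) = fock_kernel w v"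
proof -
  have "L2_inner lborel (coherent w) (coherent v) = (of_real (pi powr (- real CARD('a) / 2)) * exp (- (cdot v v + cnj (cdot w w)) / 4))
      * (of_real (pi powr (real CARD('a) / 2)) * exp (cdot (v + vec_cnj w) (v + vec_cnj w) / 4))"
    unfolding L2_inner_def coherent_prod by (simp only: integral_mult_right_zero gaussian_integral_vec(2))
  also have "\<dots> = of_real (pi powr (- real CARD('a) / 2) * pi powr (real CARD('a) / 2))
      * (exp (- (cdot v v + cnj (cdot w w)) / 4) * exp (cdot (v + vec_cnj w) (v + vec_cnj w) / 4))"
    by simp
  also have "pi powr (- real CARD('a) / 2) * pi powr (real CARD('a) / 2) = 1"
    by (simp add: powr_add[symmetric])
  also have "exp (- (cdot v v + cnj (cdot w w)) / 4) * exp (cdot (v + vec_cnj w) (v + vec_cnj w) / 4) = exp (cdot v (vec_cnj w) / 2)"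
    unfolding exp_add[symmetric]
    by (rule arg_cong[where f = exp]) (simp add: cnj_cdot cdot_add cdot_commute[of "vec_cnj w" v] field_simps)
  finally show ?thesis by (simp add: fock_kernel_def)
qed

lemma bargmann_coherent: "bargmann (coherent w) = fock_kernel w"
  by (rule ext) (simp add: bargmann_inner coherent_inner)

lemma coherent_norm_sq: "(L2_norm lborel (coherent w))\<^sup>2 = exp ((norm w)\<^sup>2 / 2)"
proof -
  have "complex_of_real ((L2_norm lborel (coherent w))\<^sup>2) = exp (complex_of_real ((norm w)\<^sup>2) / 2)"
    using coherent_inner[of w w] by (simp only: L2_inner_self fock_kernel_def cdot_vec_cnj_self)
  also have "\<dots> = complex_of_real (exp ((norm w)\<^sup>2 / 2))" by (simp flip: exp_of_real)
  finally show ?thesis by (simp only: of_real_eq_iff)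
qed

lemma bargmann_add:
  assumes "f \<in> L2 lborel" "g \<in> L2 lborel"
  shows "bargmann (\<lambda>u. f u + g u) = (\<lambda>z. bargmann f z + bargmann g z)"
  by (rule ext) (simp add: bargmann_inner L2_inner_add assms coherent_L2)

lemma bargmann_diff:
  assumes "f \<in> L2 lborel" "g \<in> L2 lborel"
  shows "bargmann (\<lambda>u. f u - g u) = (\<lambda>z. bargmann f z - bargmann g z)"
  by (rule ext) (simp add: bargmann_inner L2_inner_diff assms coherent_L2)

lemma bargmann_scale: "bargmann (\<lambda>u. c * f u) = (\<lambda>z. c * bargmann f z)"
  by (rule ext) (simp add: bargmann_inner L2_inner_scale)

lemma bargmann_measurable:
  assumes [measurable]: "f \<in> borel_measurable borel"
  shows "bargmann f \<in> borel_measurable borel"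
  unfolding bargmann_eq[abs_def] by measurable

lemma cdot_of_real_inner: "cdot (of_real_vec u) (of_real_vec b) = of_real (b \<bullet> u)"
  by (simp add: cdot_def of_real_vec_def inner_vec_def mult.commute)

text \<open>Shifting the argument of the kernel by \<open>\<i> b\<close> produces the character, and the exponential
  factors in \<open>rho_i\<close> cancel the effect of the shift on \<open>exp (- z\<^sup>2 / 4)\<close>.\<close>

lemma rho_i_bargmann: "rho_i b (bargmann f) = bargmann (\<lambda>u. cis (b \<bullet> u) * f u)"
proof
  fix z
  let ?b = "of_real_vec b"
  note bu = cdot_of_real_inner[of _ b] power2_norm_eq_inner[of b]
  have regroup: "c * A * g * B * E = P * (c * Q * g * R)" if "A * B * E = P * Q * R" for A B E P Q R c g :: complex
  proof -
    have "c * A * g * B * E = c * g * (A * B * E)" by (simp only: mult_ac)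
    also have "\<dots> = c * g * (P * Q * R)" by (simp only: that)
    finally have "c * A * g * B * E = c * g * (P * Q * R)" .
    also have "\<dots> = P * (c * Q * g * R)" by (simp only: mult_ac)
    finally show ?thesis .
  qed
  have K: "bargmann_kernel (z + \<i> *s ?b) u * (exp (1/2 * cdot (\<i> *s ?b) z) * exp (of_real (- (norm b)\<^sup>2 / 4)))
      = cis (b \<bullet> u) * bargmann_kernel z u" for u
  proof -
    have "- cdot (z + \<i> *s ?b) (z + \<i> *s ?b) / 4 + cdot (of_real_vec u) (z + \<i> *s ?b)
        + (1/2 * cdot (\<i> *s ?b) z + of_real (- (norm b)\<^sup>2 / 4))
      = \<i> * of_real (b \<bullet> u) + - cdot z z / 4 + cdot (of_real_vec u) z"
      by (simp add: cdot_add cdot_scale bu cdot_commute[of z ?b] field_simps del: of_real_power)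
    then have "exp (- cdot (z + \<i> *s ?b) (z + \<i> *s ?b) / 4) * exp (cdot (of_real_vec u) (z + \<i> *s ?b))
        * (exp (1/2 * cdot (\<i> *s ?b) z) * exp (of_real (- (norm b)\<^sup>2 / 4)))
      = cis (b \<bullet> u) * exp (- cdot z z / 4) * exp (cdot (of_real_vec u) z)"
      by (simp only: cis_conv_exp exp_add[symmetric])
    then show ?thesis unfolding bargmann_kernel_def by (rule regroup)
  qed
  have "rho_i b (bargmann f) z = (LINT u|lborel. f u * bargmann_kernel (z + \<i> *s ?b) u
      * (exp (1/2 * cdot (\<i> *s ?b) z) * exp (of_real (- (norm b)\<^sup>2 / 4))))"
    unfolding rho_i_def bargmann_eq by (subst integral_mult_left_zero) (simp only: mult.assoc)
  also have "\<dots> = (LINT u|lborel. (cis (b \<bullet> u) * f u) * bargmann_kernel z u)"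
    by (simp only: mult.assoc K mult.left_commute)
  finally show "rho_i b (bargmann f) z = bargmann (\<lambda>u. cis (b \<bullet> u) * f u) z" by (simp only: bargmann_eq)
qed

lemma L2_cis_mult: "f \<in> L2 lborel \<Longrightarrow> (\<lambda>u. cis (b \<bullet> u) * f u) \<in> L2 lborel"
  by (rule L2_bounded_mult[where C = 1]) auto

lemma coherent_0: "coherent 0 u = of_real (pi powr (- real CARD('n) / 4) * exp (- (norm (u :: real ^ 'n))\<^sup>2 / 2))"
  by (simp only: coherent_def bargmann_kernel_def cdot_zero exp_of_real complex_cnj_mult complex_cnj_complex_of_real
      minus_zero div_0 exp_zero complex_cnj_one mult_1_right of_real_mult)

lemma coherent_0_nonzero: "coherent 0 u \<noteq> 0"
  by (simp add: coherent_0)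

text \<open>A modulated Gaussian is, up to a constant, the coherent state with purely imaginary parameter;
  this is why trigonometric polynomials times the Gaussian are mapped to spans of reproducing
  kernels.\<close>

lemma modulated_gaussian:
  "(\<lambda>u. cis (b \<bullet> u) * coherent 0 u)
    = (\<lambda>u. of_real (exp (- (norm b)\<^sup>2 / 4)) * coherent (- (\<i> *s of_real_vec b)) u)"
proof
  fix u
  let ?m = "- (\<i> *s of_real_vec b)"
  have m: "?m = (- \<i>) *s of_real_vec b" by (simp add: vec_eq_iff)
  have 1: "- cdot ?m ?m / 4 = complex_of_real ((norm b)\<^sup>2 / 4)"
    unfolding m cdot_scale by (simp add: cdot_of_real_inner power2_norm_eq_inner)
  have 2: "cnj (exp (cdot (of_real_vec u) ?m)) = cis (b \<bullet> u)"
    unfolding m cdot_scale by (simp add: cdot_of_real_inner cis_conv_exp exp_cnj)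
  have c: "coherent ?m u = of_real (pi powr (- real CARD('a) / 4)) * of_real (exp ((norm b)\<^sup>2 / 4))
      * of_real (exp (- (norm u)\<^sup>2 / 2)) * cis (b \<bullet> u)"
    by (simp only: coherent_def bargmann_kernel_def 1 2 exp_of_real complex_cnj_mult complex_cnj_complex_of_real)
  have e: "complex_of_real (exp (- (norm b)\<^sup>2 / 4)) * of_real (exp ((norm b)\<^sup>2 / 4)) = 1"
    by (simp only: of_real_mult[symmetric] exp_add[symmetric]) simp
  have "of_real (exp (- (norm b)\<^sup>2 / 4)) * coherent ?m u
      = (of_real (exp (- (norm b)\<^sup>2 / 4)) * of_real (exp ((norm b)\<^sup>2 / 4)))
        * (of_real (pi powr (- real CARD('a) / 4)) * of_real (exp (- (norm u)\<^sup>2 / 2)) * cis (b \<bullet> u))"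
    unfolding c by (simp only: mult_ac)
  also have "\<dots> = cis (b \<bullet> u) * coherent 0 u"
    unfolding e coherent_0 by simp
  finally show "cis (b \<bullet> u) * coherent 0 u = of_real (exp (- (norm b)\<^sup>2 / 4)) * coherent ?m u" ..
qed

lemma trig_gaussian_L2: "p \<in> trig \<Longrightarrow> (\<lambda>u. p u * coherent 0 u) \<in> L2 lborel"
  using L2_bounded_mult[OF coherent_L2, of p] trig_bounded[of p] trig_measurable[of p] by auto

lemma fock_add: "F \<in> fock \<Longrightarrow> G \<in> fock \<Longrightarrow> (\<lambda>z. F z + G z) \<in> fock"
  by (simp add: fock_def L2_add entire_add)

lemma fock_scale: "F \<in> fock \<Longrightarrow> (\<lambda>z. c * F z) \<in> fock"
  by (simp add: fock_def L2_scale entire_mult[OF entire_const])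

lemma bargmann_modulated_gaussian:
  "bargmann (\<lambda>u. c * cis (b \<bullet> u) * coherent 0 u)
    = (\<lambda>z. (c * of_real (exp (- (norm b)\<^sup>2 / 4))) * fock_kernel (- (\<i> *s of_real_vec b)) z)"
proof -
  have "(\<lambda>u. c * cis (b \<bullet> u) * coherent 0 u) = (\<lambda>u. (c * of_real (exp (- (norm b)\<^sup>2 / 4))) * coherent (- (\<i> *s of_real_vec b)) u)"
    using modulated_gaussian[of b] by (simp add: fun_eq_iff mult.assoc)
  then show ?thesis by (simp only: bargmann_scale bargmann_coherent)
qed

lemma bargmann_trig_fock: "p \<in> trig \<Longrightarrow> bargmann (\<lambda>u. p u * coherent 0 u) \<in> fock"
proof (induction rule: trig.induct)
  case (trig_cis c b)
  show ?case unfolding bargmann_modulated_gaussian by (intro fock_scale fock_kernel_fock)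
next
  case (trig_add p q)
  then show ?case by (simp add: distrib_right bargmann_add trig_gaussian_L2 fock_add)
qed

text \<open>For coherent states both sides are values of the reproducing kernel, on the left by the
  reproducing property and on the right by the Gaussian integral.\<close>

lemma bargmann_trig_inner:
  assumes p: "p \<in> trig" and q: "q \<in> trig"
  shows "L2_inner fock_measure (bargmann (\<lambda>u. p u * coherent 0 u)) (bargmann (\<lambda>u. q u * coherent 0 u))
    = L2_inner lborel (\<lambda>u. p u * coherent 0 u) (\<lambda>u. q u * coherent 0 u)"
  using p
proof (induction rule: trig.induct)
  case (trig_cis c b)
  show ?case using q
  proof (induction rule: trig.induct)
    case (trig_cis d a)
    have m: "(\<lambda>u. c * cis (b \<bullet> u) * coherent 0 u) = (\<lambda>u. (c * of_real (exp (- (norm b)\<^sup>2 / 4))) * coherent (- (\<i> *s of_real_vec b)) u)" for c b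
      using modulated_gaussian[of b] by (simp add: fun_eq_iff mult.assoc)
    show ?case unfolding m
      by (simp only: bargmann_scale bargmann_coherent L2_inner_scale coherent_inner fock_reproducing[OF fock_kernel_fock])
  next
    case (trig_add q r)
    then show ?case
      using bargmann_trig_fock[OF trig.trig_cis[of c b]] trig_gaussian_L2[OF trig.trig_cis[of c b]]
      by (simp add: distrib_right bargmann_add trig_gaussian_L2 bargmann_trig_fock[unfolded fock_def, simplified] L2_inner_add fock_def)
  qed
next
  case (trig_add p r)
  then show ?case
    using q by (simp add: distrib_right bargmann_add trig_gaussian_L2 bargmann_trig_fock[unfolded fock_def, simplified] L2_inner_add)
qed

text \<open>Multiplication by \<open>g\<close> identifies \<open>L\<^sup>2\<close> of the weighted measure with a part of the unweighted
  space, which transfers density results for finite measures to Lebesgue measure.\<close>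

lemma L2_density_weight:
  assumes g[measurable]: "g \<in> borel_measurable borel" and q[measurable]: "q \<in> borel_measurable borel"
  defines "M \<equiv> density (lborel :: 'a::euclidean_space measure) (\<lambda>u. ennreal ((norm (g u :: complex))\<^sup>2))"
  shows "q \<in> L2 M \<longleftrightarrow> (\<lambda>u. q u * g u) \<in> L2 lborel" "L2_norm M q = L2_norm lborel (\<lambda>u. q u * g u)"
proof -
  have eq: "(norm (q u * g u))\<^sup>2 = (norm (g u))\<^sup>2 *\<^sub>R (norm (q u))\<^sup>2" for u
    by (simp add: norm_mult power_mult_distrib)
  have "integrable M (\<lambda>u. (norm (q u))\<^sup>2) \<longleftrightarrow> integrable lborel (\<lambda>u. (norm (q u * g u))\<^sup>2)"
    unfolding M_def eq by (rule integrable_density) auto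
  then show "q \<in> L2 M \<longleftrightarrow> (\<lambda>u. q u * g u) \<in> L2 lborel" by (simp add: L2_def M_def)
  have "(LINT u|M. (norm (q u))\<^sup>2) = (LINT u|lborel. (norm (q u * g u))\<^sup>2)"
    unfolding M_def eq by (rule integral_density) auto
  then show "L2_norm M q = L2_norm lborel (\<lambda>u. q u * g u)" by (simp only: L2_norm_def)
qed

lemma finite_borel_density:
  assumes "g \<in> L2 lborel"
  shows "finite_borel_measure (density lborel (\<lambda>u. ennreal ((norm (g u))\<^sup>2)))"
proof (rule finite_borel_measure.intro, rule finite_measureI)
  have [measurable]: "g \<in> borel_measurable borel" using L2_measurable[OF assms] by simp
  show "emeasure (density lborel (\<lambda>u. ennreal ((norm (g u))\<^sup>2))) (space (density lborel (\<lambda>u. ennreal ((norm (g u))\<^sup>2)))) \<noteq> \<infinity>"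
    by (simp add: emeasure_density L2_norm_eq_nn[OF assms])
qed (simp add: finite_borel_measure_axioms_def)

lemma trig_gaussian_dense:
  assumes f: "f \<in> L2 lborel"
  shows "\<exists>p. (\<forall>n. p n \<in> trig) \<and> (\<lambda>n. L2_norm lborel (\<lambda>u. p n u * coherent 0 u - f u)) \<longlonglongrightarrow> 0"
proof -
  interpret finite_borel_measure "density lborel (\<lambda>u. ennreal ((norm (coherent 0 u :: complex))\<^sup>2))"
    by (rule finite_borel_density[OF coherent_L2])
  have [measurable]: "f \<in> borel_measurable borel" using L2_measurable[OF f] by simp
  define q where "q u = f u / coherent 0 u" for u
  have [measurable]: "q \<in> borel_measurable borel" unfolding q_def by measurable
  have qf: "(\<lambda>u. q u * coherent 0 u) = f" by (simp add: q_def coherent_0_nonzero)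
  have "q \<in> trig_closure" by (rule trig_dense) (simp add: L2_density_weight qf f)
  then obtain p where p: "\<And>n. p n \<in> trig"
    "(\<lambda>n. L2_norm (density lborel (\<lambda>u. ennreal ((norm (coherent 0 u))\<^sup>2))) (\<lambda>u. p n u - q u)) \<longlonglongrightarrow> 0"
    using closure_sequence by blast
  have [measurable]: "p n \<in> borel_measurable borel" for n using p(1) by auto
  have "L2_norm (density lborel (\<lambda>u. ennreal ((norm (coherent 0 u))\<^sup>2))) (\<lambda>u. p n u - q u)
      = L2_norm lborel (\<lambda>u. p n u * coherent 0 u - f u)" for n
    by (subst L2_density_weight(2)) (auto simp: left_diff_distrib fun_cong[OF qf])
  with p show ?thesis by auto
qed

text \<open>Since convergence of \<open>f\<close> in \<open>L\<^sup>2\<close> implies pointwise convergence of \<open>B f\<close>, Fatou's lemma and the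
  isometry on the dense subspace show that it is contractive.  Then \<open>B\<close> is continuous, and the
  equality of norms extends as well.\<close>

theorem bargmann_isometry:
  assumes f: "f \<in> L2 lborel"
  shows "bargmann f \<in> L2 fock_measure" "L2_norm fock_measure (bargmann f) = L2_norm lborel f"
proof -
  have trig_norm: "L2_norm fock_measure (bargmann (\<lambda>u. p u * coherent 0 u)) = L2_norm lborel (\<lambda>u. p u * coherent 0 u)"
    if "p \<in> trig" for p :: "real ^ 'n \<Rightarrow> complex"
    using bargmann_trig_inner[OF that that] unfolding L2_inner_self of_real_eq_iff
    by (simp add: L2_norm_nonneg)
  have trig_L2: "bargmann (\<lambda>u. p u * coherent 0 u) \<in> L2 fock_measure" if "p \<in> trig" for p :: "real ^ 'n \<Rightarrow> complex"
    using bargmann_trig_fock[OF that] by (simp add: fock_def)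
  have contr: "bargmann h \<in> L2 fock_measure" "L2_norm fock_measure (bargmann h) \<le> L2_norm lborel h"
    if h: "h \<in> L2 lborel" for h :: "real ^ 'n \<Rightarrow> complex"
  proof -
    have [measurable]: "h \<in> borel_measurable borel" using L2_measurable[OF h] by simp
    obtain p where p: "\<And>n. p n \<in> trig" "(\<lambda>n. L2_norm lborel (\<lambda>u. p n u * coherent 0 u - h u)) \<longlonglongrightarrow> 0"
      using trig_gaussian_dense[OF h] by blast
    have m: "bargmann h \<in> borel_measurable fock_measure"
      using bargmann_measurable[of h] by simp
    have lim: "AE z in fock_measure. (\<lambda>n. bargmann (\<lambda>u. p n u * coherent 0 u) z) \<longlonglongrightarrow> bargmann h z"
      unfolding bargmann_inner
      by (intro AE_I2 L2_inner_tendsto(1)[OF h trig_gaussian_L2[OF p(1)] coherent_L2 p(2)])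
    have c: "(\<lambda>n. L2_norm lborel (\<lambda>u. p n u * coherent 0 u)) \<longlonglongrightarrow> L2_norm lborel h"
      by (rule L2_norm_tendsto[OF h trig_gaussian_L2[OF p(1)] p(2)])
    show "bargmann h \<in> L2 fock_measure" "L2_norm fock_measure (bargmann h) \<le> L2_norm lborel h"
      by (rule L2_Fatou[OF m trig_L2[OF p(1)] lim _ c], simp add: trig_norm[OF p(1)])+
  qed
  show Bf: "bargmann f \<in> L2 fock_measure" by (rule contr[OF f])
  obtain p where p: "\<And>n. p n \<in> trig" "(\<lambda>n. L2_norm lborel (\<lambda>u. p n u * coherent 0 u - f u)) \<longlonglongrightarrow> 0"
    using trig_gaussian_dense[OF f] by blast
  have "(\<lambda>n. L2_norm fock_measure (\<lambda>z. bargmann (\<lambda>u. p n u * coherent 0 u) z - bargmann f z)) \<longlonglongrightarrow> 0"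
  proof (rule Lim_null_comparison[OF always_eventually p(2)], rule allI)
    fix n
    show "norm (L2_norm fock_measure (\<lambda>z. bargmann (\<lambda>u. p n u * coherent 0 u) z - bargmann f z))
      \<le> L2_norm lborel (\<lambda>u. p n u * coherent 0 u - f u)"
      using contr(2)[OF L2_diff[OF trig_gaussian_L2[OF p(1)] f], of n]
      by (simp add: bargmann_diff[OF trig_gaussian_L2[OF p(1)] f] L2_norm_nonneg)
  qed
  then have "(\<lambda>n. L2_norm fock_measure (bargmann (\<lambda>u. p n u * coherent 0 u))) \<longlonglongrightarrow> L2_norm fock_measure (bargmann f)"
    by (rule L2_norm_tendsto[OF Bf trig_L2[OF p(1)]])
  moreover have "(\<lambda>n. L2_norm fock_measure (bargmann (\<lambda>u. p n u * coherent 0 u))) \<longlonglongrightarrow> L2_norm lborel f"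
    unfolding trig_norm[OF p(1)] by (rule L2_norm_tendsto[OF f trig_gaussian_L2[OF p(1)] p(2)])
  ultimately show "L2_norm fock_measure (bargmann f) = L2_norm lborel f" by (rule LIMSEQ_unique)
qed

section \<open>The adjoint of the Bargmann transform\<close>

lemma L2_fock_measurable: "F \<in> L2 fock_measure \<Longrightarrow> F \<in> borel_measurable borel"
  using L2_measurable[of F fock_measure] measurable_cong_sets[OF sets_fock_measure refl] by blast

interpretation fock_lborel: pair_sigma_finite "fock_measure :: (complex ^ 'n) measure" "lborel :: (real ^ 'n) measure" ..

text \<open>The formal adjoint of the transform.  For a general square integrable \<open>\<Phi>\<close> the integral need
  not converge absolutely, since \<open>coherent z u\<close> is not square integrable in \<open>z\<close>; the lemmas
  below assume that \<open>\<Phi>\<close> vanishes outside a ball.\<close>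

definition ball_adj :: "(complex ^ 'n \<Rightarrow> complex) \<Rightarrow> real ^ 'n \<Rightarrow> complex" where
  "ball_adj \<Phi> u = (LINT z|fock_measure. \<Phi> z * coherent z u)"

lemma ball_kernel_L2: "(\<lambda>z. (if norm z \<le> R then coherent z u else 0)) \<in> L2 fock_measure"
proof -
  have "continuous_on (cball 0 R) (\<lambda>z. coherent z u)"
    unfolding coherent_def bargmann_kernel_def by (intro continuous_intros) auto
  then have "bounded ((\<lambda>z. coherent z u) ` cball 0 R)"
    by (intro compact_imp_bounded compact_continuous_image) auto
  then obtain C where "\<forall>z\<in>cball 0 R. norm (coherent z u) \<le> C" unfolding bounded_iff by blast
  then have C: "norm (coherent z u) \<le> C" if "norm z \<le> R" for z using that by simp
  show ?thesis
  proof (rule L2_bound)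
    show "(\<lambda>z. (if norm z \<le> R then coherent z u else 0)) \<in> borel_measurable fock_measure"
      unfolding coherent_def by measurable
    show "integrable fock_measure (\<lambda>z. C\<^sup>2)" by simp
    show "AE z in fock_measure. (norm ((if norm z \<le> R then coherent z u else 0)))\<^sup>2 \<le> C\<^sup>2"
      using C by (intro AE_I2) (auto intro: power_mono)
  qed
qed

context
  fixes \<Phi> :: "complex ^ 'n \<Rightarrow> complex" and R :: real
  assumes L: "\<Phi> \<in> L2 fock_measure" and supp: "\<And>z. R < norm z \<Longrightarrow> \<Phi> z = 0"
begin

lemma ball_support_factor: "\<Phi> z * coherent z u = \<Phi> z * ((if norm z \<le> R then coherent z u else 0))"
  using supp[of z] by (cases "norm z \<le> R") auto

lemma ball_adj_integrable: "integrable fock_measure (\<lambda>z. \<Phi> z * coherent z u)"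
  unfolding ball_support_factor by (rule L2_prod_integrable[OF L ball_kernel_L2])

text \<open>Cauchy-Schwarz in \<open>z\<close> and Tonelli's theorem reduce the claim to the bound \<open>exp (R\<^sup>2 / 2)\<close> for
  the squared norms of the coherent states with parameter in the ball.\<close>

lemma ball_adj_L2: "ball_adj \<Phi> \<in> L2 lborel"
proof -
  note [measurable] = L2_fock_measurable[OF L]
  have [measurable]: "(\<lambda>p. coherent (fst p) (snd p)) \<in> borel_measurable (borel \<Otimes>\<^sub>M borel)"
    unfolding coherent_def by measurable
  have m: "ball_adj \<Phi> \<in> borel_measurable lborel"
    unfolding ball_adj_def[abs_def] coherent_def by measurable
  define k where "k u z = (if norm z \<le> R then coherent z u else 0)" for u :: "real ^ 'n" and z
  have "(\<integral>\<^sup>+u. ennreal ((norm (ball_adj \<Phi> u))\<^sup>2) \<partial>lborel)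
      \<le> (\<integral>\<^sup>+u. ennreal ((L2_norm fock_measure \<Phi>)\<^sup>2) * (\<integral>\<^sup>+z. ennreal ((norm (k u z))\<^sup>2) \<partial>fock_measure) \<partial>lborel)"
  proof (rule nn_integral_mono)
    fix u
    have "ball_adj \<Phi> u = L2_inner fock_measure \<Phi> (\<lambda>z. cnj (k u z))"
      unfolding ball_adj_def L2_inner_def k_def by (simp only: complex_cnj_cnj ball_support_factor)
    then have "norm (ball_adj \<Phi> u) \<le> L2_norm fock_measure \<Phi> * L2_norm fock_measure (\<lambda>z. cnj (k u z))"
      using L2_Cauchy_Schwarz[OF L L2_cnj[OF ball_kernel_L2]] by (simp add: k_def)
    also have "L2_norm fock_measure (\<lambda>z. cnj (k u z)) = L2_norm fock_measure (k u)" by (simp add: L2_norm_def)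
    finally have "(norm (ball_adj \<Phi> u))\<^sup>2 \<le> (L2_norm fock_measure \<Phi> * L2_norm fock_measure (k u))\<^sup>2"
      by (rule power_mono) simp
    then have "ennreal ((norm (ball_adj \<Phi> u))\<^sup>2) \<le> ennreal ((L2_norm fock_measure \<Phi>)\<^sup>2) * ennreal ((L2_norm fock_measure (k u))\<^sup>2)"
      by (simp add: ennreal_mult[symmetric] power_mult_distrib del: ennreal_power)
    also have "ennreal ((L2_norm fock_measure (k u))\<^sup>2) = (\<integral>\<^sup>+z. ennreal ((norm (k u z))\<^sup>2) \<partial>fock_measure)"
      unfolding k_def by (rule L2_norm_eq_nn[OF ball_kernel_L2, symmetric])
    finally show "ennreal ((norm (ball_adj \<Phi> u))\<^sup>2) \<le> ennreal ((L2_norm fock_measure \<Phi>)\<^sup>2) * (\<integral>\<^sup>+z. ennreal ((norm (k u z))\<^sup>2) \<partial>fock_measure)" .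
  qed
  also have "\<dots> = ennreal ((L2_norm fock_measure \<Phi>)\<^sup>2) * (\<integral>\<^sup>+u. (\<integral>\<^sup>+z. ennreal ((norm (k u z))\<^sup>2) \<partial>fock_measure) \<partial>lborel)"
    unfolding k_def coherent_def by (rule nn_integral_cmult) measurable
  also have "(\<integral>\<^sup>+u. (\<integral>\<^sup>+z. ennreal ((norm (k u z))\<^sup>2) \<partial>fock_measure) \<partial>lborel)
      = (\<integral>\<^sup>+z. (\<integral>\<^sup>+u. ennreal ((norm (k u z))\<^sup>2) \<partial>lborel) \<partial>fock_measure)"
    unfolding k_def coherent_def by (rule fock_lborel.Fubini') measurable
  also have "\<dots> \<le> (\<integral>\<^sup>+z. ennreal (exp (R\<^sup>2 / 2)) \<partial>(fock_measure :: (complex ^ 'n) measure))"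
  proof (rule nn_integral_mono)
    fix z :: "complex ^ 'n"
    show "(\<integral>\<^sup>+u. ennreal ((norm (k u z))\<^sup>2) \<partial>lborel) \<le> ennreal (exp (R\<^sup>2 / 2))"
    proof (cases "norm z \<le> R")
      case True
      then have "(\<integral>\<^sup>+u. ennreal ((norm (k u z))\<^sup>2) \<partial>lborel) = (\<integral>\<^sup>+u. ennreal ((norm (coherent z u))\<^sup>2) \<partial>lborel)"
        by (simp add: k_def)
      also have "\<dots> = ennreal (exp ((norm z)\<^sup>2 / 2))"
        by (simp only: L2_norm_eq_nn[OF coherent_L2] coherent_norm_sq)
      also have "\<dots> \<le> ennreal (exp (R\<^sup>2 / 2))" using True by (simp add: power_mono)
      finally show ?thesis .
    qed (simp add: k_def)
  qed
  also have "\<dots> = ennreal (exp (R\<^sup>2 / 2))" by (simp add: emeasure_fock_measure)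
  finally have "(\<integral>\<^sup>+u. ennreal ((norm (ball_adj \<Phi> u))\<^sup>2) \<partial>lborel) \<le> ennreal ((L2_norm fock_measure \<Phi>)\<^sup>2) * ennreal (exp (R\<^sup>2 / 2))"
    by (simp add: mult_left_mono)
  then have "(\<integral>\<^sup>+u. ennreal ((norm (ball_adj \<Phi> u))\<^sup>2) \<partial>lborel) \<le> ennreal ((L2_norm fock_measure \<Phi> * exp (R\<^sup>2 / 4))\<^sup>2)"
    by (simp add: ennreal_mult[symmetric] power_mult_distrib power2_eq_square[of "exp _"] exp_add[symmetric] del: ennreal_power)
  from L2_nnI(1)[OF m this] show ?thesis by (simp add: L2_norm_nonneg)
qed

lemma ball_adj_adjoint:
  assumes g: "g \<in> L2 lborel"
  shows "L2_inner fock_measure (bargmann g) \<Phi> = L2_inner lborel g (ball_adj \<Phi>)"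
proof -
  note [measurable] = L2_fock_measurable[OF L] L2_lborel_measurable[OF g]
  let ?H = "\<lambda>z u. g u * cnj (coherent z u) * cnj (\<Phi> z)"
  have int: "integrable (fock_measure \<Otimes>\<^sub>M lborel) (\<lambda>p. ?H (fst p) (snd p))"
  proof (rule fock_lborel.Fubini_integrable)
    show "(\<lambda>p. ?H (fst p) (snd p)) \<in> borel_measurable (fock_measure \<Otimes>\<^sub>M lborel)"
      unfolding coherent_def by measurable
    show "AE z in fock_measure. integrable lborel (\<lambda>u. ?H (fst (z, u)) (snd (z, u)))"
      by (simp add: L2_inner_integrable[OF g coherent_L2])
    show "integrable fock_measure (\<lambda>z. LINT u|lborel. norm (?H (fst (z, u)) (snd (z, u))))"
    proof (rule Bochner_Integration.integrable_bound)
      have "integrable fock_measure (\<lambda>z. \<Phi> z * 1)"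
        by (rule L2_prod_integrable[OF L]) (simp add: L2_def)
      then show "integrable fock_measure (\<lambda>z. (L2_norm lborel g * exp (R\<^sup>2 / 4)) * norm (\<Phi> z))"
        by (intro integrable_mult_right integrable_norm) simp
      show "(\<lambda>z. LINT u|lborel. norm (?H (fst (z, u)) (snd (z, u)))) \<in> borel_measurable fock_measure"
        unfolding coherent_def by measurable
      have "norm (LINT u|lborel. norm (?H z u)) \<le> norm ((L2_norm lborel g * exp (R\<^sup>2 / 4)) * norm (\<Phi> z))" for z
      proof -
        have "(LINT u|lborel. norm (?H z u)) = (LINT u|lborel. norm (g u) * norm (coherent z u)) * norm (\<Phi> z)"
          by (simp add: norm_mult)
        also have "\<dots> \<le> (L2_norm lborel g * exp (R\<^sup>2 / 4)) * norm (\<Phi> z)"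
        proof (cases "norm z \<le> R")
          case True
          have "(L2_norm lborel (coherent z))\<^sup>2 \<le> (exp (R\<^sup>2 / 4))\<^sup>2"
            using True by (simp add: coherent_norm_sq power2_eq_square[of "exp _"] exp_add[symmetric] power_mono)
          then have "L2_norm lborel (coherent z) \<le> exp (R\<^sup>2 / 4)" by (rule power2_le_imp_le) simp
          then have "L2_norm lborel g * L2_norm lborel (coherent z) \<le> L2_norm lborel g * exp (R\<^sup>2 / 4)"
            by (rule mult_left_mono[OF _ L2_norm_nonneg])
          with L2_Cauchy_Schwarz_abs[OF g coherent_L2[of z]] show ?thesis
            by (intro mult_right_mono) auto
        qed (simp add: supp)
        finally show ?thesis by (simp add: L2_norm_nonneg)
      qed
      then show "AE z in fock_measure. norm (LINT u|lborel. norm (?H (fst (z, u)) (snd (z, u))))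
          \<le> norm ((L2_norm lborel g * exp (R\<^sup>2 / 4)) * norm (\<Phi> z))" by simp
    qed
  qed
  then have int': "integrable (fock_measure \<Otimes>\<^sub>M lborel) (\<lambda>(z, u). ?H z u)" by (simp add: split_beta')
  have "L2_inner fock_measure (bargmann g) \<Phi> = (LINT z|fock_measure. (LINT u|lborel. ?H z u))"
    unfolding L2_inner_def bargmann_inner by simp
  also have "\<dots> = (LINT u|lborel. (LINT z|fock_measure. ?H z u))"
    by (rule fock_lborel.Fubini_integral[OF int', symmetric])
  also have "\<dots> = (LINT u|lborel. g u * cnj (ball_adj \<Phi> u))"
  proof (rule Bochner_Integration.integral_cong[OF refl])
    fix u
    have "(LINT z|fock_measure. ?H z u) = (LINT z|fock_measure. g u * cnj (\<Phi> z * coherent z u))"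
      by (simp add: mult_ac)
    then show "(LINT z|fock_measure. ?H z u) = g u * cnj (ball_adj \<Phi> u)"
      by (simp only: integral_mult_right_zero Bochner_Integration.integral_cnj ball_adj_def)
  qed
  finally show ?thesis by (simp only: L2_inner_def)
qed

text \<open>With \<open>f = ball_adj \<Phi>\<close> the squared norm of \<open>f\<close> is the inner product of \<open>B f\<close> and \<open>\<Phi>\<close>, and
  \<open>B f\<close> has the norm of \<open>f\<close>.\<close>

lemma ball_adj_norm: "L2_norm lborel (ball_adj \<Phi>) \<le> L2_norm fock_measure \<Phi>"
proof -
  let ?f = "ball_adj \<Phi>"
  have "(L2_norm lborel ?f)\<^sup>2 = norm (L2_inner lborel ?f ?f)" unfolding L2_inner_self norm_of_real by simp
  also have "\<dots> = norm (L2_inner fock_measure (bargmann ?f) \<Phi>)" by (simp only: ball_adj_adjoint[OF ball_adj_L2])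
  also have "\<dots> \<le> L2_norm lborel ?f * L2_norm fock_measure \<Phi>"
    using L2_Cauchy_Schwarz[OF bargmann_isometry(1)[OF ball_adj_L2] L] by (simp add: bargmann_isometry(2)[OF ball_adj_L2])
  finally have "L2_norm lborel ?f * L2_norm lborel ?f \<le> L2_norm lborel ?f * L2_norm fock_measure \<Phi>" by (simp add: power2_eq_square)
  then show ?thesis
    using L2_norm_nonneg[of lborel ?f] L2_norm_nonneg[of fock_measure \<Phi>] by (cases "L2_norm lborel ?f = 0") auto
qed

end

text \<open>The truncations of \<open>F\<close> to balls form a Cauchy sequence, hence so do their images under the norm
  decreasing map \<open>ball_adj\<close>; the adjoint relation passes to the limit.\<close>

theorem bargmann_adjoint_exists:
  fixes F :: "complex ^ 'n \<Rightarrow> complex"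
  assumes F: "F \<in> L2 fock_measure"
  shows "\<exists>f. f \<in> L2 lborel \<and> (\<forall>g\<in>L2 lborel. L2_inner fock_measure (bargmann g) F = L2_inner lborel g f)"
proof -
  define T where "T k z = (if norm z \<le> real k then F z else 0)" for k :: nat and z :: "complex ^ 'n"
  have [measurable]: "F \<in> borel_measurable borel" by (rule L2_fock_measurable[OF F])
  have T: "T k \<in> L2 fock_measure" for k
  proof (rule L2_bound[OF _ L2_integrable_sq[OF F]])
    show "T k \<in> borel_measurable fock_measure" unfolding T_def by measurable
  qed (simp add: T_def)
  have Tsupp: "T k z = 0" if "real k < norm z" for k and z :: "complex ^ 'n"
    using that by (simp add: T_def)
  have Tlim: "(\<lambda>k. L2_norm fock_measure (\<lambda>z. T k z - F z)) \<longlonglongrightarrow> 0"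
  proof (rule L2_dominated)
    show "integrable fock_measure (\<lambda>z. (norm (F z))\<^sup>2)" by (rule L2_integrable_sq[OF F])
    show "AE z in fock_measure. (norm (T k z - F z))\<^sup>2 \<le> (norm (F z))\<^sup>2" for k
      by (intro AE_I2) (simp add: T_def)
    show "AE z in fock_measure. (\<lambda>k. T k z) \<longlonglongrightarrow> F z"
    proof (rule AE_I2)
      fix z :: "complex ^ 'n"
      obtain k0 where "norm z \<le> real k0" using real_arch_simple by blast
      then have "\<forall>\<^sub>F k in sequentially. T k z = F z"
        by (intro eventually_sequentiallyI[of k0]) (simp add: T_def)
      then show "(\<lambda>k. T k z) \<longlonglongrightarrow> F z" by (rule tendsto_eventually)
    qed
  qed (use T F in auto)
  define f where "f k = ball_adj (T k)" for k
  have fL: "f k \<in> L2 lborel" for k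
    unfolding f_def by (rule ball_adj_L2[OF T Tsupp])
  have fdiff: "L2_norm lborel (\<lambda>u. f i u - f j u) \<le> L2_norm fock_measure (\<lambda>z. T i z - T j z)" for i j
  proof -
    have "(\<lambda>u. f i u - f j u) = ball_adj (\<lambda>z. T i z - T j z)"
      unfolding f_def ball_adj_def left_diff_distrib
      by (subst Bochner_Integration.integral_diff) (auto intro: ball_adj_integrable[OF T Tsupp])
    moreover have "L2_norm lborel (ball_adj (\<lambda>z. T i z - T j z)) \<le> L2_norm fock_measure (\<lambda>z. T i z - T j z)"
      by (rule ball_adj_norm[OF L2_diff[OF T T], of "max (real i) (real j)"]) (simp add: Tsupp)
    ultimately show ?thesis by simp
  qed
  have "\<exists>f0\<in>L2 lborel. (\<lambda>n. L2_norm lborel (\<lambda>x. f n x - f0 x)) \<longlonglongrightarrow> 0"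
  proof (rule L2_complete[OF fL])
    fix e :: real assume "0 < e"
    then obtain N where N: "\<And>k. k \<ge> N \<Longrightarrow> L2_norm fock_measure (\<lambda>z. T k z - F z) < e / 2"
      using order_tendstoD(2)[OF Tlim, of "e / 2"] by (auto simp: eventually_sequentially)
    show "\<exists>N. \<forall>i\<ge>N. \<forall>j\<ge>N. L2_norm lborel (\<lambda>x. f i x - f j x) \<le> e"
    proof (intro exI allI impI)
      fix i j assume ij: "N \<le> i" "N \<le> j"
      have "L2_norm lborel (\<lambda>x. f i x - f j x) \<le> L2_norm fock_measure (\<lambda>z. T i z - F z) + L2_norm fock_measure (\<lambda>z. F z - T j z)"
        using fdiff[of i j] L2_norm_triangle_diff[OF T F T, of i j] by simp
      then show "L2_norm lborel (\<lambda>x. f i x - f j x) \<le> e"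
        using N[OF ij(1)] N[OF ij(2)] by (simp add: L2_norm_minus[of fock_measure F])
    qed
  qed
  then obtain f0 where f0: "f0 \<in> L2 lborel" "(\<lambda>n. L2_norm lborel (\<lambda>x. f n x - f0 x)) \<longlonglongrightarrow> 0" by blast
  have "L2_inner fock_measure (bargmann g) F = L2_inner lborel g f0" if g: "g \<in> L2 lborel" for g
  proof (rule LIMSEQ_unique)
    show "(\<lambda>n. L2_inner lborel g (f n)) \<longlonglongrightarrow> L2_inner lborel g f0"
      by (rule L2_inner_tendsto(2)[OF f0(1) fL g f0(2)])
    have "L2_inner lborel g (f n) = L2_inner fock_measure (bargmann g) (T n)" for n
      unfolding f_def by (rule ball_adj_adjoint[OF T Tsupp g, symmetric])
    then show "(\<lambda>n. L2_inner lborel g (f n)) \<longlonglongrightarrow> L2_inner fock_measure (bargmann g) F"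
      using L2_inner_tendsto(2)[OF F T bargmann_isometry(1)[OF g] Tlim] by simp
  qed
  with f0(1) show ?thesis by blast
qed

lemma bargmann_adj_spec:
  assumes "F \<in> L2 fock_measure"
  shows "bargmann_adj F \<in> L2 lborel"
    "g \<in> L2 lborel \<Longrightarrow> L2_inner fock_measure (bargmann g) F = L2_inner lborel g (bargmann_adj F)"
  using someI_ex[OF bargmann_adjoint_exists[OF assms], folded bargmann_adj_def] by blast+

text \<open>The adjoint relation tested on \<open>coherent z\<close>, whose transform reproduces the value at \<open>z\<close>.\<close>

theorem bargmann_bargmann_adj:
  assumes F: "F \<in> fock"
  shows "bargmann (bargmann_adj F) = F"
proof
  fix z
  have L: "F \<in> L2 fock_measure" using F by (simp add: fock_def)
  have "bargmann (bargmann_adj F) z = cnj (L2_inner lborel (coherent z) (bargmann_adj F))"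
    by (simp only: bargmann_inner L2_inner_commute[of lborel "bargmann_adj F"])
  also have "\<dots> = cnj (L2_inner fock_measure (fock_kernel z) F)"
    by (simp only: bargmann_adj_spec(2)[OF L coherent_L2, symmetric] bargmann_coherent)
  also have "\<dots> = F z"
    by (simp only: L2_inner_commute[of fock_measure F, symmetric] fock_reproducing[OF F])
  finally show "bargmann (bargmann_adj F) z = F z" .
qed

section \<open>Operators commuting with the unitaries \<open>rho_i b\<close>\<close>

lemma rho_i_scale: "rho_i b (\<lambda>z. c * F z) = (\<lambda>z. c * rho_i b F z)"
  by (simp add: rho_i_def mult.assoc)

lemma rho_i_fock:
  assumes F: "F \<in> fock" shows "rho_i b F \<in> fock"
proof -
  have eF: "entire F" and L: "F \<in> L2 fock_measure" using F by (auto simp: fock_def)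
  have "rho_i b F = (\<lambda>z. F (z + \<i> *s of_real_vec b) * exp (cdot z ((1/2) *s (\<i> *s of_real_vec b)))
      * exp (complex_of_real (- (norm b)\<^sup>2 / 4)))"
    unfolding rho_i_def cdot_scale(2)[of _ "1/2"] by (simp only: cdot_commute)
  moreover have "entire \<dots>"
    by (rule entire_mult[OF entire_mult[OF entire_translate[OF eF] entire_exp_cdot] entire_const])
  moreover have "rho_i b F \<in> L2 fock_measure"
    using bargmann_isometry(1)[OF L2_cis_mult[OF bargmann_adj_spec(1)[OF L]], of b]
    by (simp only: rho_i_bargmann[symmetric] bargmann_bargmann_adj[OF F])
  ultimately show ?thesis by (simp add: fock_def)
qed

lemma bargmann_inj_AE:
  assumes f: "f \<in> L2 lborel" and g: "g \<in> L2 lborel" and eq: "bargmann f = bargmann g"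
  shows "AE u in lborel. f u = g u"
proof -
  have "L2_norm lborel (\<lambda>u. f u - g u) = L2_norm fock_measure (\<lambda>z. bargmann f z - bargmann g z)"
    using bargmann_isometry(2)[OF L2_diff[OF f g]] by (simp only: bargmann_diff[OF f g])
  also have "\<dots> = 0" by (simp add: eq L2_norm_def)
  finally have "AE u in lborel. f u - g u = 0" by (rule L2_norm_zero_AE[OF L2_diff[OF f g]])
  then show ?thesis by simp
qed

lemma bargmann_cong_AE:
  assumes [measurable]: "f \<in> borel_measurable borel" "g \<in> borel_measurable borel"
    and eq: "AE u in lborel. f u = g u"
  shows "bargmann f = bargmann g"
proof
  fix z
  show "bargmann f z = bargmann g z"
    unfolding bargmann_eq using eq by (intro integral_cong_AE) (auto elim!: eventually_mono)
qed

lemma bargmann_adj_rho_i: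
  assumes F: "F \<in> fock"
  shows "AE u in lborel. bargmann_adj (rho_i b F) u = cis (b \<bullet> u) * bargmann_adj F u"
proof (rule bargmann_inj_AE)
  have L: "F \<in> L2 fock_measure" "rho_i b F \<in> L2 fock_measure"
    using F rho_i_fock[OF F] by (auto simp: fock_def)
  show "bargmann_adj (rho_i b F) \<in> L2 lborel" by (rule bargmann_adj_spec[OF L(2)])
  show "(\<lambda>u. cis (b \<bullet> u) * bargmann_adj F u) \<in> L2 lborel"
    by (rule L2_cis_mult[OF bargmann_adj_spec(1)[OF L(1)]])
  show "bargmann (bargmann_adj (rho_i b F)) = bargmann (\<lambda>u. cis (b \<bullet> u) * bargmann_adj F u)"
    by (simp only: bargmann_bargmann_adj[OF rho_i_fock[OF F]] rho_i_bargmann[symmetric] bargmann_bargmann_adj[OF F])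
qed

text \<open>The constant compensates the factor that normalizes \<open>bargmann\<close>.\<close>

lemma multiplier_integral:
  fixes z :: "complex ^ 'n"
  shows "exp (- cdot z z / 4) * (LINT \<xi>|lborel. m \<xi> * f \<xi> * exp (complex_of_real (- (norm \<xi>)\<^sup>2 / 2)) * exp (cdot z (of_real_vec \<xi>)))
    = of_real (pi powr (real CARD('n) / 4)) * bargmann (\<lambda>\<xi>. m \<xi> * f \<xi>) z"
proof -
  have "complex_of_real (pi powr (real CARD('n) / 4)) * of_real (pi powr (- real CARD('n) / 4)) = 1"
    by (simp only: of_real_mult[symmetric] powr_add[symmetric]) simp
  then show ?thesis
    unfolding bargmann_def cdot_commute[of z "of_real_vec _"] mult.assoc[of "of_real _" "of_real _", symmetric]
    by simp
qed

text \<open>The operator is followed on the dense set of products of trigonometric polynomials with the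
  Gaussian \<open>k = coherent 0\<close>, where the commutation relation makes it multiplication by
  \<open>\<psi> / k\<close>.  One approximation must serve \<open>q * k\<close> and \<open>q * \<psi>\<close> simultaneously, so the
  density theorem is applied to the finite measure with density \<open>\<bar>k\<bar>\<^sup>2 + \<bar>\<psi>\<bar>\<^sup>2\<close>.\<close>

lemma commuting_imp_multiplier:
  fixes S :: "(complex ^ 'n \<Rightarrow> complex) \<Rightarrow> (complex ^ 'n \<Rightarrow> complex)"
  assumes S: "fock_bounded_linear S"
    and comm: "\<And>b F. F \<in> fock \<Longrightarrow> S (rho_i b F) = rho_i b (S F)"
  shows "\<exists>m\<in>Linfty lborel. \<forall>F\<in>fock. S F = bargmann (\<lambda>\<xi>. m \<xi> * bargmann_adj F \<xi>)"
proof -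
  let ?k = "coherent 0 :: real ^ 'n \<Rightarrow> complex"
  have S_fock: "S F \<in> fock" if "F \<in> fock" for F using S that by (simp add: fock_bounded_linear_def)
  have S_add: "S (\<lambda>z. F z + G z) = (\<lambda>z. S F z + S G z)" if "F \<in> fock" "G \<in> fock" for F G
    using S that by (simp add: fock_bounded_linear_def)
  have S_scale: "S (\<lambda>z. c * F z) = (\<lambda>z. c * S F z)" if "F \<in> fock" for F c
    using S that by (simp add: fock_bounded_linear_def)
  have S_diff: "S (\<lambda>z. F z - G z) = (\<lambda>z. S F z - S G z)" "(\<lambda>z. F z - G z) \<in> fock" if "F \<in> fock" "G \<in> fock" for F G
    using S_add[OF that(1) fock_scale[OF that(2)], of "-1"] S_scale[OF that(2), of "-1"]
      fock_add[OF that(1) fock_scale[OF that(2)], of "-1"] by simp_all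
  obtain K where K: "\<And>F. F \<in> fock \<Longrightarrow> L2_norm fock_measure (S F) \<le> K * L2_norm fock_measure F"
    using S unfolding fock_bounded_linear_def by blast
  have fock_L2: "F \<in> L2 fock_measure" if "F \<in> fock" for F :: "complex ^ 'n \<Rightarrow> complex" using that by (simp add: fock_def)
  have k0: "bargmann ?k \<in> fock" by (simp only: bargmann_coherent fock_kernel_fock)
  have K_nonneg: "0 \<le> K"
  proof -
    have "L2_norm fock_measure (bargmann ?k) = 1"
      by (simp add: bargmann_coherent fock_kernel_cdot vec_cnj_def L2_norm_def cdot_def fock_prob.prob_space[simplified])
    then show ?thesis using K[OF k0] L2_norm_nonneg[of fock_measure "S (bargmann ?k)"] by simp
  qed
  have kL: "?k \<in> L2 lborel" by (rule coherent_L2)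
  define \<psi> where "\<psi> = bargmann_adj (S (bargmann ?k))"
  have \<psi>: "\<psi> \<in> L2 lborel" unfolding \<psi>_def by (rule bargmann_adj_spec[OF fock_L2[OF S_fock[OF k0]]])
  have B\<psi>: "bargmann \<psi> = S (bargmann ?k)" unfolding \<psi>_def by (rule bargmann_bargmann_adj[OF S_fock[OF k0]])
  have [measurable]: "\<psi> \<in> borel_measurable borel" by (rule L2_lborel_measurable[OF \<psi>])
  have trig\<psi>: "(\<lambda>u. p u * \<psi> u) \<in> L2 lborel" if "p \<in> trig" for p
    using L2_bounded_mult[OF \<psi>, of p] trig_bounded[OF that] trig_measurable[OF that] by auto
  have S_trig: "S (bargmann (\<lambda>u. p u * ?k u)) = bargmann (\<lambda>u. p u * \<psi> u)" if "p \<in> trig" for p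
    using that
  proof (induction rule: trig.induct)
    case (trig_cis c b)
    have "S (bargmann (\<lambda>u. c * cis (b \<bullet> u) * ?k u)) = S (\<lambda>z. c * rho_i b (bargmann ?k) z)"
      by (simp only: mult.assoc bargmann_scale rho_i_bargmann)
    also have "\<dots> = (\<lambda>z. c * rho_i b (bargmann \<psi>) z)"
      by (simp only: S_scale[OF rho_i_fock[OF k0]] comm[OF k0] B\<psi>)
    also have "\<dots> = bargmann (\<lambda>u. c * cis (b \<bullet> u) * \<psi> u)"
      by (simp only: mult.assoc bargmann_scale rho_i_bargmann)
    finally show ?case .
  next
    case (trig_add p q)
    then show ?case
      by (simp add: distrib_right bargmann_add trig_gaussian_L2 trig\<psi> S_add bargmann_trig_fock)
  qed
  define g where "g u = complex_of_real (sqrt ((norm (?k u))\<^sup>2 + (norm (\<psi> u))\<^sup>2))" for u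
  have [measurable]: "g \<in> borel_measurable borel" unfolding g_def by measurable
  have ng: "(norm (g u))\<^sup>2 = (norm (?k u))\<^sup>2 + (norm (\<psi> u))\<^sup>2" for u by (simp add: g_def)
  have gk: "norm (?k u) \<le> norm (g u)" and g\<psi>: "norm (\<psi> u) \<le> norm (g u)" for u
    by (rule power2_le_imp_le; simp add: ng)+
  have gL: "g \<in> L2 lborel"
    by (rule L2_bound[OF _ Bochner_Integration.integrable_add[OF L2_integrable_sq[OF kL] L2_integrable_sq[OF \<psi>]]]) (simp_all add: ng)
  define M where "M = density lborel (\<lambda>u. ennreal ((norm (g u))\<^sup>2))"
  interpret M: finite_borel_measure M unfolding M_def by (rule finite_borel_density[OF gL])
  have approx: "\<exists>p. (\<forall>n. p n \<in> trig) \<and> (\<lambda>u. q u * ?k u) \<in> L2 lborel \<and> (\<lambda>u. q u * \<psi> u) \<in> L2 lborel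
      \<and> (\<lambda>n. L2_norm lborel (\<lambda>u. p n u * ?k u - q u * ?k u)) \<longlonglongrightarrow> 0
      \<and> (\<lambda>n. L2_norm lborel (\<lambda>u. p n u * \<psi> u - q u * \<psi> u)) \<longlonglongrightarrow> 0"
    if q: "q \<in> L2 M" and [measurable]: "q \<in> borel_measurable borel" for q
  proof -
    have qg: "(\<lambda>u. q u * g u) \<in> L2 lborel" using q by (simp add: M_def L2_density_weight)
    obtain p where p: "\<And>n. p n \<in> trig" "(\<lambda>n. L2_norm M (\<lambda>u. p n u - q u)) \<longlonglongrightarrow> 0"
      using M.closure_sequence[OF M.trig_dense[OF q]] by blast
    have [measurable]: "p n \<in> borel_measurable borel" for n using p(1) by auto
    have dg: "(\<lambda>u. (p n u - q u) * g u) \<in> L2 lborel" for n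
      using L2_diff[OF M.trig_L2[OF p(1)] q, of n] unfolding M_def by (subst (asm) L2_density_weight) auto
    have lim: "(\<lambda>n. L2_norm lborel (\<lambda>u. p n u * h u - q u * h u)) \<longlonglongrightarrow> 0"
      if [measurable]: "h \<in> borel_measurable borel" and h: "\<And>u. norm (h u) \<le> norm (g u)" for h
    proof (rule Lim_null_comparison[OF always_eventually p(2)], rule allI)
      fix n
      have "L2_norm lborel (\<lambda>u. (p n u - q u) * h u) \<le> L2_norm lborel (\<lambda>u. (p n u - q u) * g u)"
        by (rule L2_norm_mono(2)[OF dg]) (auto simp: norm_mult h mult_left_mono)
      also have "\<dots> = L2_norm M (\<lambda>u. p n u - q u)"
        unfolding M_def by (subst L2_density_weight) auto
      finally show "norm (L2_norm lborel (\<lambda>u. p n u * h u - q u * h u)) \<le> L2_norm M (\<lambda>u. p n u - q u)"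
        by (simp add: L2_norm_nonneg left_diff_distrib)
    qed
    have "(\<lambda>u. q u * h u) \<in> L2 lborel"
      if [measurable]: "h \<in> borel_measurable borel" and h: "\<And>u. norm (h u) \<le> norm (g u)" for h
      by (rule L2_norm_mono(1)[OF qg]) (auto simp: norm_mult h mult_left_mono)
    then show ?thesis using p(1) lim gk g\<psi> by (intro exI[of _ p]) simp
  qed
  have bound: "L2_norm lborel (\<lambda>u. q u * \<psi> u) \<le> K * L2_norm lborel (\<lambda>u. q u * ?k u)"
    if q: "q \<in> L2 M" "q \<in> borel_measurable borel" for q
  proof -
    obtain p where p: "\<And>n. p n \<in> trig" and L: "(\<lambda>u. q u * ?k u) \<in> L2 lborel" "(\<lambda>u. q u * \<psi> u) \<in> L2 lborel"
      and lim: "(\<lambda>n. L2_norm lborel (\<lambda>u. p n u * ?k u - q u * ?k u)) \<longlonglongrightarrow> 0"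
        "(\<lambda>n. L2_norm lborel (\<lambda>u. p n u * \<psi> u - q u * \<psi> u)) \<longlonglongrightarrow> 0"
      using approx[OF q] by blast
    show ?thesis
    proof (rule LIMSEQ_le)
      show "(\<lambda>n. L2_norm lborel (\<lambda>u. p n u * \<psi> u)) \<longlonglongrightarrow> L2_norm lborel (\<lambda>u. q u * \<psi> u)"
        by (rule L2_norm_tendsto[OF L(2) trig\<psi>[OF p] lim(2)])
      show "(\<lambda>n. K * L2_norm lborel (\<lambda>u. p n u * ?k u)) \<longlonglongrightarrow> K * L2_norm lborel (\<lambda>u. q u * ?k u)"
        by (intro tendsto_intros L2_norm_tendsto[OF L(1) trig_gaussian_L2[OF p] lim(1)])
      have "L2_norm lborel (\<lambda>u. p n u * \<psi> u) \<le> K * L2_norm lborel (\<lambda>u. p n u * ?k u)" for n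
        using K[OF bargmann_trig_fock[OF p[of n]]]
        by (simp only: S_trig[OF p] bargmann_isometry(2)[OF trig\<psi>[OF p]] bargmann_isometry(2)[OF trig_gaussian_L2[OF p]])
      then show "\<exists>N. \<forall>n\<ge>N. L2_norm lborel (\<lambda>u. p n u * \<psi> u) \<le> K * L2_norm lborel (\<lambda>u. p n u * ?k u)" by blast
    qed
  qed
  have S_eq: "S (bargmann (\<lambda>u. q u * ?k u)) = bargmann (\<lambda>u. q u * \<psi> u)"
    if q: "q \<in> L2 M" "q \<in> borel_measurable borel" and F: "bargmann (\<lambda>u. q u * ?k u) \<in> fock" for q
  proof
    fix z
    obtain p where p: "\<And>n. p n \<in> trig" and L: "(\<lambda>u. q u * ?k u) \<in> L2 lborel" "(\<lambda>u. q u * \<psi> u) \<in> L2 lborel"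
      and lim: "(\<lambda>n. L2_norm lborel (\<lambda>u. p n u * ?k u - q u * ?k u)) \<longlonglongrightarrow> 0"
        "(\<lambda>n. L2_norm lborel (\<lambda>u. p n u * \<psi> u - q u * \<psi> u)) \<longlonglongrightarrow> 0"
      using approx[OF q] by blast
    let ?F = "bargmann (\<lambda>u. q u * ?k u)" and ?P = "\<lambda>n. bargmann (\<lambda>u. p n u * ?k u)"
    have P: "?P n \<in> fock" for n by (rule bargmann_trig_fock[OF p])
    have "(\<lambda>n. L2_norm fock_measure (\<lambda>z. S (?P n) z - S ?F z)) \<longlonglongrightarrow> 0"
    proof (rule Lim_null_comparison[OF always_eventually tendsto_mult_right_zero[OF lim(1), of K]], rule allI)
      fix n
      have "L2_norm fock_measure (\<lambda>z. S (?P n) z - S ?F z) \<le> K * L2_norm fock_measure (\<lambda>z. ?P n z - ?F z)"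
        using K[OF S_diff(2)[OF P F]] by (simp only: S_diff(1)[OF P F])
      also have "L2_norm fock_measure (\<lambda>z. ?P n z - ?F z) = L2_norm lborel (\<lambda>u. p n u * ?k u - q u * ?k u)"
        by (simp only: bargmann_diff[OF trig_gaussian_L2[OF p] L(1), symmetric] bargmann_isometry(2)[OF L2_diff[OF trig_gaussian_L2[OF p] L(1)]])
      finally show "norm (L2_norm fock_measure (\<lambda>z. S (?P n) z - S ?F z)) \<le> K * L2_norm lborel (\<lambda>u. p n u * ?k u - q u * ?k u)"
        by (simp add: L2_norm_nonneg)
    qed
    from L2_inner_tendsto(1)[OF fock_L2[OF S_fock[OF F]] fock_L2[OF S_fock[OF P]] fock_kernel_L2[of z] this]
    \<comment> \<open>Point evaluations are continuous on the Fock space by the reproducing property.\<close>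
    have 1: "(\<lambda>n. S (?P n) z) \<longlonglongrightarrow> S ?F z"
      by (simp only: fock_reproducing[OF S_fock[OF P]] fock_reproducing[OF S_fock[OF F]])
    have 2: "(\<lambda>n. S (?P n) z) \<longlonglongrightarrow> bargmann (\<lambda>u. q u * \<psi> u) z"
      unfolding S_trig[OF p] bargmann_inner by (rule L2_inner_tendsto(1)[OF L(2) trig\<psi>[OF p] coherent_L2 lim(2)])
    show "S ?F z = bargmann (\<lambda>u. q u * \<psi> u) z" using 1 2 by (rule LIMSEQ_unique)
  qed
  \<comment> \<open>The bound on \<open>\<psi>\<close> follows by testing the operator bound on the set where it fails.\<close>
  have \<psi>_le: "AE u in lborel. norm (\<psi> u) \<le> K * norm (?k u)"
  proof -
    define A where "A = {u. K * norm (?k u) < norm (\<psi> u)}"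
    have A[measurable]: "A \<in> sets borel" unfolding A_def by measurable
    let ?q = "\<lambda>u. indicator A u :: complex"
    have q: "?q \<in> L2 M" by (rule M.bounded_L2[where C = 1]) (auto simp: indicator_def)
    have int: "integrable lborel (\<lambda>u. (norm (?q u * \<psi> u))\<^sup>2)" "integrable lborel (\<lambda>u. (norm (?q u * ?k u))\<^sup>2)"
      using approx[OF q] L2_integrable_sq by auto
    define h where "h u = (norm (?q u * \<psi> u))\<^sup>2 - K\<^sup>2 * (norm (?q u * ?k u))\<^sup>2" for u
    have h: "integrable lborel h" unfolding h_def[abs_def] using int by simp
    have pos: "h u > 0" if "u \<in> A" for u
    proof -
      have "(K * norm (?k u))\<^sup>2 < (norm (\<psi> u))\<^sup>2"
        using that K_nonneg by (intro power_strict_mono) (auto simp: A_def)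
      then show ?thesis using that by (simp add: h_def power_mult_distrib)
    qed
    have zero: "h u = 0" if "u \<notin> A" for u using that by (simp add: h_def)
    have "(L2_norm lborel (\<lambda>u. ?q u * \<psi> u))\<^sup>2 \<le> (K * L2_norm lborel (\<lambda>u. ?q u * ?k u))\<^sup>2"
      using bound[OF q] by (intro power_mono) (auto simp: L2_norm_nonneg)
    then have "(LINT u|lborel. h u) \<le> 0"
      unfolding h_def using int by (simp add: L2_norm_sq power_mult_distrib)
    moreover have nn: "h u \<ge> 0" for u using pos[of u] zero[of u] by (cases "u \<in> A") auto
    moreover have "0 \<le> (LINT u|lborel. h u)" by (rule integral_nonneg_AE) (simp add: nn)
    ultimately have "(LINT u|lborel. h u) = 0" by linarith
    then have "AE u in lborel. h u = 0" using integral_nonneg_eq_0_iff_AE[OF h AE_I2[OF nn]] by blast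
    then show ?thesis
    proof eventually_elim
      case (elim u)
      then show ?case using pos[of u] by (auto simp: A_def not_less[symmetric])
    qed
  qed
  define m where "m u = \<psi> u / ?k u" for u
  have [measurable]: "m \<in> borel_measurable borel" unfolding m_def by measurable
  have mK: "AE u in lborel. norm (m u) \<le> K"
    using \<psi>_le by eventually_elim (simp add: m_def norm_divide divide_le_eq coherent_0_nonzero)
  have "S F = bargmann (\<lambda>\<xi>. m \<xi> * bargmann_adj F \<xi>)" if F: "F \<in> fock" for F
  proof -
    let ?f = "bargmann_adj F"
    have f: "?f \<in> L2 lborel" by (rule bargmann_adj_spec[OF fock_L2[OF F]])
    have [measurable]: "?f \<in> borel_measurable borel" by (rule L2_lborel_measurable[OF f])
    define q where "q u = ?f u / ?k u" for u
    have [measurable]: "q \<in> borel_measurable borel" unfolding q_def by measurable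
    have qk: "(\<lambda>u. q u * ?k u) = ?f" by (simp add: q_def coherent_0_nonzero)
    have q\<psi>: "(\<lambda>u. q u * \<psi> u) = (\<lambda>u. m u * ?f u)" by (simp add: q_def m_def mult.commute)
    have "(\<lambda>u. q u * g u) \<in> L2 lborel"
    proof (rule L2_bound)
      \<comment> \<open>Membership in the weighted space costs the factor \<open>1 + K\<^sup>2\<close>, by the bound on \<open>\<psi> / k\<close>.\<close>
      show "integrable lborel (\<lambda>u. (norm (?f u))\<^sup>2 + K\<^sup>2 * (norm (?f u))\<^sup>2)"
        using L2_integrable_sq[OF f] by simp
      show "AE u in lborel. (norm (q u * g u))\<^sup>2 \<le> (norm (?f u))\<^sup>2 + K\<^sup>2 * (norm (?f u))\<^sup>2"
        using mK
      proof eventually_elim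
        case (elim u)
        have "(norm (q u * g u))\<^sup>2 = (norm (q u * ?k u))\<^sup>2 + (norm (q u * \<psi> u))\<^sup>2"
          by (simp only: norm_mult power_mult_distrib ng distrib_left)
        also have "\<dots> = (norm (?f u))\<^sup>2 + (norm (m u))\<^sup>2 * (norm (?f u))\<^sup>2"
          by (simp only: fun_cong[OF qk] fun_cong[OF q\<psi>] norm_mult power_mult_distrib)
        also have "\<dots> \<le> (norm (?f u))\<^sup>2 + K\<^sup>2 * (norm (?f u))\<^sup>2"
          using elim by (intro add_left_mono mult_right_mono power_mono) auto
        finally show ?case .
      qed
    qed measurable
    then have q: "q \<in> L2 M" by (simp add: M_def L2_density_weight)
    have "bargmann (\<lambda>u. q u * ?k u) = F" by (simp only: qk bargmann_bargmann_adj[OF F])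
    with S_eq[OF q] F show ?thesis by (simp only: q\<psi>) simp
  qed
  moreover have "m \<in> Linfty lborel" using mK by (auto simp: Linfty_def)
  ultimately show ?thesis by blast
qed

text \<open>Only the almost everywhere class of \<open>bargmann_adj (rho_i b F)\<close> is known, and the integral does not
  see more.\<close>

lemma multiplier_imp_commuting:
  fixes S :: "(complex ^ 'n \<Rightarrow> complex) \<Rightarrow> (complex ^ 'n \<Rightarrow> complex)"
  assumes m: "m \<in> borel_measurable borel"
    and S: "\<And>F. F \<in> fock \<Longrightarrow> S F = (\<lambda>z. k * bargmann (\<lambda>\<xi>. m \<xi> * bargmann_adj F \<xi>) z)"
    and F: "F \<in> fock"
  shows "S (rho_i b F) = rho_i b (S F)"
proof -
  have L: "F \<in> L2 fock_measure" "rho_i b F \<in> L2 fock_measure"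
    using F rho_i_fock[OF F] by (auto simp: fock_def)
  note [measurable] = m L2_lborel_measurable[OF bargmann_adj_spec(1)[OF L(1)]]
    L2_lborel_measurable[OF bargmann_adj_spec(1)[OF L(2)]]
  have "bargmann (\<lambda>\<xi>. m \<xi> * bargmann_adj (rho_i b F) \<xi>) = bargmann (\<lambda>\<xi>. cis (b \<bullet> \<xi>) * (m \<xi> * bargmann_adj F \<xi>))"
  proof (rule bargmann_cong_AE)
    show "AE u in lborel. m u * bargmann_adj (rho_i b F) u = cis (b \<bullet> u) * (m u * bargmann_adj F u)"
      using bargmann_adj_rho_i[OF F, of b] by eventually_elim simp
  qed measurable
  then show ?thesis
    by (simp only: S[OF F] S[OF rho_i_fock[OF F]] rho_i_scale rho_i_bargmann)
qed

theorem theorem1p4: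
  fixes S :: "(complex ^ 'n \<Rightarrow> complex) \<Rightarrow> (complex ^ 'n \<Rightarrow> complex)"
  assumes "fock_bounded_linear S"
  shows "(\<forall>b. \<forall>F\<in>fock. S (rho_i b F) = rho_i b (S F)) \<longleftrightarrow>
    (\<exists>m\<in>Linfty (lborel :: (real ^ 'n) measure). \<forall>F\<in>fock. \<forall>z.
      S F z = exp (- cdot z z / 4) *
        (LINT \<xi>|lborel. m \<xi> * bargmann_adj F \<xi> * exp (complex_of_real (- (norm \<xi>)\<^sup>2 / 2))
          * exp (cdot z (of_real_vec \<xi>))))"
  unfolding multiplier_integral
proof
  assume "\<forall>b. \<forall>F\<in>fock. S (rho_i b F) = rho_i b (S F)"
  then obtain m where m: "m \<in> Linfty lborel" "\<And>F. F \<in> fock \<Longrightarrow> S F = bargmann (\<lambda>\<xi>. m \<xi> * bargmann_adj F \<xi>)"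
    using commuting_imp_multiplier[OF assms] by blast
  let ?c = "complex_of_real (pi powr (real CARD('n) / 4))" and ?d = "complex_of_real (pi powr (- real CARD('n) / 4))"
  have cd: "?c * ?d = 1"
    by (simp only: of_real_mult[symmetric] powr_add[symmetric]) simp
  show "\<exists>m\<in>Linfty lborel. \<forall>F\<in>fock. \<forall>z. S F z = ?c * bargmann (\<lambda>\<xi>. m \<xi> * bargmann_adj F \<xi>) z"
  proof (intro bexI ballI allI)
    obtain K where "AE x in lborel. norm (m x) \<le> K" using m(1) by (auto simp: Linfty_def)
    then have "AE x in lborel. norm (?d * m x) \<le> norm ?d * K"
      by eventually_elim (simp only: norm_mult mult_left_mono norm_ge_zero)
    moreover have "(\<lambda>x. ?d * m x) \<in> borel_measurable lborel"
      using m(1) by (intro borel_measurable_times borel_measurable_const) (simp add: Linfty_def)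
    ultimately show "(\<lambda>x. ?d * m x) \<in> Linfty lborel" unfolding Linfty_def by blast
    fix F :: "complex ^ 'n \<Rightarrow> complex" and z assume "F \<in> fock"
    then have "S F z = (?c * ?d) * bargmann (\<lambda>\<xi>. m \<xi> * bargmann_adj F \<xi>) z" by (simp only: m(2) cd mult_1_left)
    then show "S F z = ?c * bargmann (\<lambda>\<xi>. ?d * m \<xi> * bargmann_adj F \<xi>) z"
      by (simp only: mult.assoc bargmann_scale)
  qed
next
  assume "\<exists>m\<in>Linfty lborel. \<forall>F\<in>fock. \<forall>z.
    S F z = of_real (pi powr (real CARD('n) / 4)) * bargmann (\<lambda>\<xi>. m \<xi> * bargmann_adj F \<xi>) z"
  then obtain m where m: "m \<in> Linfty lborel" and SF: "\<forall>F\<in>fock. \<forall>z.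
      S F z = of_real (pi powr (real CARD('n) / 4)) * bargmann (\<lambda>\<xi>. m \<xi> * bargmann_adj F \<xi>) z"
    by (elim bexE)
  have SF': "S F = (\<lambda>z. of_real (pi powr (real CARD('n) / 4)) * bargmann (\<lambda>\<xi>. m \<xi> * bargmann_adj F \<xi>) z)"
    if "F \<in> fock" for F
    using SF that by (intro ext) simp
  have "m \<in> borel_measurable borel" using m by (simp add: Linfty_def)
  then show "\<forall>b. \<forall>F\<in>fock. S (rho_i b F) = rho_i b (S F)"
    by (intro allI ballI multiplier_imp_commuting[OF _ SF'])
qed

end
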